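(* Let \(\mathcal M\) be a classifying space of type (I) or (II). Then the subgroup \[H=\{g\in G: Gr(g)\text{ is a real automorphism of }W_k/W_{k-2}\text{ for all }k\}\] acts transitively on \(\mathcal M\) by isometries; that is, \(H\) acts transitively on \(\mathcal M\), and for every \(g\in H\) and \(F\in\mathcal M\) the differential \(L_{g*}:T_F(\mathcal M)\to T_{g.F}(\mathcal M)\) of \(F\mapsto g.F\) is an isometry for the hermitian metric on \(T(\mathcal M)\) induced by the mixed Hodge metric.
   Context: \(V_{\mathbb Q}\) finite-dimensional over \(\mathbb Q\), \(V_{\mathbb R}=V_{\mathbb Q}\otimes\mathbb R\), \(V=V_{\mathbb Q}\otimes\mathbb C\), \(W\) an increasing rational filtration, \(Q=\{Q_k\}\) nondegenerate rational bilinear forms on \(Gr^W_k\) of parity \((-1)^k\). \(\mathcal M\) is the set of decreasing filtrations \(F\) of \(V\) with fixed \(\dim F^p\) such that \((F,W)\) is a mixed Hodge structure graded-polarized by \(Q\). \(G=\{g\in GL(V): g(W_k)=W_k\ \forall k,\ Gr(g)\text{ is a real automorphism of each }Q_k\}\); \(G_{\mathbb C}\) is defined with complex automorphisms; \(\mathfrak g_{\mathbb C}=\mathrm{Lie}(G_{\mathbb C})\). Deligne bigrading of \((F,W)\): unique \(V=\bigoplus I^{p,q}\) with \(F^p=\bigoplus_{a\ge p}I^{a,b}\), \(W_k=\bigoplus_{a+b\le k}I^{a,b}\), \(\overline{I^{p,q}}\equiv I^{q,p}\bmod\bigoplus_{r<q,s<p}I^{r,s}\); \(\mathfrak g^{r,s}_{\mathbb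 C}\) = elements of \(\mathfrak g_{\mathbb C}\) mapping \(I^{p,q}\) into \(I^{p+r,q+s}\). Type (I): for some \(k\), \(\dim I^{p,q}=0\) unless \(p+q\in\{k,k-1\}\); type (II): for some \(k\), \(\dim I^{p,q}=0\) unless \(p+q=2k-1\) or \((p,q)\in\{(k,k),(k-1,k-1)\}\). Metric. The mixed Hodge metric \(h_F\) on \(V\) makes the \(I^{p,q}\) orthogonal with \(h_F(u,v)=i^{p-q}Q_{p+q}([u],[\bar v])\) for \(u,v\in I^{p,q}\). \(T_F\mathcal M\) is identified with \(\mathfrak t_F=\bigoplus_{r<0}\mathfrak g^{r,s}_{\mathbb C}\) via \(u\mapsto\frac{d}{dt}\exp(tu).F|_{t=0}\), with hermitian metric \(h_F(\alpha,\beta)=\mathrm{Tr}(\alpha\beta^* )\), adjoint taken with respect to \(h_F\) on \(V\). *)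

theory Defs
  imports "HOL-Analysis.Analysis"
begin

text \<open>The rational vector space V_Q is modelled as Q^n (n = CARD('n)), so that
  V = C^n = complex^'n, with rational structure given by the rational coordinates
  and complex conjugation acting coordinatewise.  Endomorphisms of V are
  complex n x n matrices.\<close>


definition vcnj :: "(complex^('n::finite)) \<Rightarrow> (complex^('n::finite))" where
  "vcnj v = (\<chi> i. cnj (v $ i))"

definition rat_vec :: "(complex^('n::finite)) \<Rightarrow> bool" where
  "rat_vec v \<longleftrightarrow> (\<forall>i. v $ i \<in> \<rat>)"

definition cspan :: "(complex^('n::finite)) set \<Rightarrow> (complex^('n::finite)) set" where
  "cspan S = {v. \<exists>T c. finite T \<and> T \<subseteq> S \<and> v = (\<Sum>x\<in>T. c x *s x)}"

definition csubspace :: "(complex^('n::finite)) set \<Rightarrow> bool" where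
  "csubspace S \<longleftrightarrow> 0 \<in> S \<and> (\<forall>x\<in>S. \<forall>y\<in>S. x + y \<in> S) \<and> (\<forall>c. \<forall>x\<in>S. c *s x \<in> S)"

definition cdim :: "(complex^('n::finite)) set \<Rightarrow> nat" where
  "cdim S = (LEAST m. \<exists>B. finite B \<and> B \<subseteq> S \<and> card B = m \<and> cspan B = S)"

definition sumsp :: "(complex^('n::finite)) set \<Rightarrow> (complex^('n::finite)) set \<Rightarrow> (complex^('n::finite)) set" where
  "sumsp A B = {a + b |a b. a \<in> A \<and> b \<in> B}"

definition cnjset :: "(complex^('n::finite)) set \<Rightarrow> (complex^('n::finite)) set" where
  "cnjset S = vcnj ` S"

definition weight_filtration :: "(int \<Rightarrow> (complex^('n::finite)) set) \<Rightarrow> bool" where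
  "weight_filtration W \<longleftrightarrow>
     (\<forall>k. csubspace (W k)) \<and> (\<forall>k. W k \<subseteq> W (k + 1)) \<and>
     (\<exists>a b. \<forall>k. (k \<le> a \<longrightarrow> W k = {0}) \<and> (b \<le> k \<longrightarrow> W k = UNIV)) \<and>
     (\<forall>k. W k = cspan (W k \<inter> {v. rat_vec v}))"

text \<open>Q k is a bilinear form on W_k which descends to Gr^W_k = W_k/W_(k-1);
  nondegenerate on Gr^W_k, rational, of parity (-1)^k.  Values of Q k outside
  W_k are irrelevant.\<close>
definition graded_forms :: "(int \<Rightarrow> (complex^('n::finite)) set) \<Rightarrow> (int \<Rightarrow> (complex^('n::finite)) \<Rightarrow> (complex^('n::finite)) \<Rightarrow> complex) \<Rightarrow> bool" where
  "graded_forms W Q \<longleftrightarrow> (\<forall>k.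
     (\<forall>u\<in>W k. \<forall>u'\<in>W k. \<forall>v\<in>W k. Q k (u + u') v = Q k u v + Q k u' v) \<and>
     (\<forall>u\<in>W k. \<forall>v\<in>W k. \<forall>v'\<in>W k. Q k u (v + v') = Q k u v + Q k u v') \<and>
     (\<forall>c. \<forall>u\<in>W k. \<forall>v\<in>W k. Q k (c *s u) v = c * Q k u v \<and> Q k u (c *s v) = c * Q k u v) \<and>
     (\<forall>u\<in>W (k - 1). \<forall>v\<in>W k. Q k u v = 0 \<and> Q k v u = 0) \<and>
     (\<forall>u\<in>W k. (\<forall>v\<in>W k. Q k u v = 0) \<longrightarrow> u \<in> W (k - 1)) \<and>
     (\<forall>u\<in>W k. \<forall>v\<in>W k. Q k v u = (-1) powi k * Q k u v) \<and>
     (\<forall>u\<in>W k. \<forall>v\<in>W k. rat_vec u \<longrightarrow> rat_vec v \<longrightarrow> Q k u v \<in> \<rat>))"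

definition hodge_filtration :: "(int \<Rightarrow> (complex^('n::finite)) set) \<Rightarrow> bool" where
  "hodge_filtration F \<longleftrightarrow> (\<forall>p. csubspace (F p)) \<and> (\<forall>p. F (p + 1) \<subseteq> F p) \<and>
     (\<exists>a b. \<forall>p. (p \<le> a \<longrightarrow> F p = UNIV) \<and> (b \<le> p \<longrightarrow> F p = {0}))"

text \<open>Lift to W_k of F^p Gr^W_k.\<close>
definition Fgr :: "(int \<Rightarrow> (complex^('n::finite)) set) \<Rightarrow> (int \<Rightarrow> (complex^('n::finite)) set) \<Rightarrow> int \<Rightarrow> int \<Rightarrow> (complex^('n::finite)) set" where
  "Fgr W F k p = sumsp (F p \<inter> W k) (W (k - 1))"

text \<open>(F,W) is a mixed Hodge structure: F induces a pure Hodge structure of weight k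
  on Gr^W_k, i.e. F^p Gr_k (+) conj(F^(k-p+1) Gr_k) = Gr_k for all p.\<close>
definition is_MHS :: "(int \<Rightarrow> (complex^('n::finite)) set) \<Rightarrow> (int \<Rightarrow> (complex^('n::finite)) set) \<Rightarrow> bool" where
  "is_MHS W F \<longleftrightarrow> (\<forall>k p.
     sumsp (Fgr W F k p) (cnjset (Fgr W F k (k - p + 1))) = W k \<and>
     Fgr W F k p \<inter> cnjset (Fgr W F k (k - p + 1)) = W (k - 1))"

text \<open>Lift to W_k of H^(p,k-p) = F^p Gr_k \<inter> conj(F^(k-p) Gr_k).\<close>
definition hodge_lift :: "(int \<Rightarrow> (complex^('n::finite)) set) \<Rightarrow> (int \<Rightarrow> (complex^('n::finite)) set) \<Rightarrow> int \<Rightarrow> int \<Rightarrow> (complex^('n::finite)) set" where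
  "hodge_lift W F k p = Fgr W F k p \<inter> cnjset (Fgr W F k (k - p))"

definition graded_polarized ::
  "(int \<Rightarrow> (complex^('n::finite)) set) \<Rightarrow> (int \<Rightarrow> (complex^('n::finite)) \<Rightarrow> (complex^('n::finite)) \<Rightarrow> complex) \<Rightarrow> (int \<Rightarrow> (complex^('n::finite)) set) \<Rightarrow> bool" where
  "graded_polarized W Q F \<longleftrightarrow> (\<forall>k p.
     (\<forall>u\<in>F p \<inter> W k. \<forall>v\<in>F (k - p + 1) \<inter> W k. Q k u v = 0) \<and>
     (\<forall>v\<in>hodge_lift W F k p. v \<notin> W (k - 1) \<longrightarrow>
        Im (\<i> powi (p - (k - p)) * Q k v (vcnj v)) = 0 \<and>
        Re (\<i> powi (p - (k - p)) * Q k v (vcnj v)) > 0))"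

definition classifying_space ::
  "(int \<Rightarrow> (complex^('n::finite)) set) \<Rightarrow> (int \<Rightarrow> (complex^('n::finite)) \<Rightarrow> (complex^('n::finite)) \<Rightarrow> complex) \<Rightarrow> (int \<Rightarrow> nat) \<Rightarrow> (int \<Rightarrow> (complex^('n::finite)) set) set" where
  "classifying_space W Q hdim = {F. hodge_filtration F \<and> (\<forall>p. cdim (F p) = hdim p) \<and>
      is_MHS W F \<and> graded_polarized W Q F}"

text \<open>Gr(g) real on W_k/W_(k-j)\<close>
definition gr_real :: "(int \<Rightarrow> (complex^('n::finite)) set) \<Rightarrow> int \<Rightarrow> (complex^('n::finite)^'n) \<Rightarrow> bool" where
  "gr_real W j g \<longleftrightarrow> (\<forall>k. \<forall>v\<in>W k. vcnj (g *v v) - g *v (vcnj v) \<in> W (k - j))"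

definition Ggrp :: "(int \<Rightarrow> (complex^('n::finite)) set) \<Rightarrow> (int \<Rightarrow> (complex^('n::finite)) \<Rightarrow> (complex^('n::finite)) \<Rightarrow> complex) \<Rightarrow> (complex^('n::finite)^'n) set" where
  "Ggrp W Q = {g. invertible g \<and> (\<forall>k. (\<lambda>v. g *v v) ` W k = W k) \<and> gr_real W 1 g \<and>
      (\<forall>k. \<forall>u\<in>W k. \<forall>v\<in>W k. Q k (g *v u) (g *v v) = Q k u v)}"

definition Hgrp :: "(int \<Rightarrow> (complex^('n::finite)) set) \<Rightarrow> (int \<Rightarrow> (complex^('n::finite)) \<Rightarrow> (complex^('n::finite)) \<Rightarrow> complex) \<Rightarrow> (complex^('n::finite)^'n) set" where
  "Hgrp W Q = {g \<in> Ggrp W Q. gr_real W 2 g}"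

definition lie_gC :: "(int \<Rightarrow> (complex^('n::finite)) set) \<Rightarrow> (int \<Rightarrow> (complex^('n::finite)) \<Rightarrow> (complex^('n::finite)) \<Rightarrow> complex) \<Rightarrow> (complex^('n::finite)^'n) set" where
  "lie_gC W Q = {X. (\<forall>k. \<forall>v\<in>W k. X *v v \<in> W k) \<and>
      (\<forall>k. \<forall>u\<in>W k. \<forall>v\<in>W k. Q k (X *v u) v + Q k u (X *v v) = 0)}"

definition is_bigrading :: "(int \<Rightarrow> int \<Rightarrow> (complex^('n::finite)) set) \<Rightarrow> bool" where
  "is_bigrading I \<longleftrightarrow> (\<forall>p q. csubspace (I p q)) \<and> finite {(p, q). I p q \<noteq> {0}} \<and>
     cspan (\<Union>p q. I p q) = UNIV \<and>
     (\<forall>S f. finite S \<longrightarrow> (\<forall>(p, q)\<in>S. f (p, q) \<in> I p q) \<longrightarrow> sum f S = 0 \<longrightarrow> (\<forall>x\<in>S. f x = 0))"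

definition is_deligne :: "(int \<Rightarrow> (complex^('n::finite)) set) \<Rightarrow> (int \<Rightarrow> (complex^('n::finite)) set) \<Rightarrow> (int \<Rightarrow> int \<Rightarrow> (complex^('n::finite)) set) \<Rightarrow> bool" where
  "is_deligne W F I \<longleftrightarrow> is_bigrading I \<and>
     (\<forall>p. F p = cspan (\<Union>{I a b |a b. p \<le> a})) \<and>
     (\<forall>k. W k = cspan (\<Union>{I a b |a b. a + b \<le> k})) \<and>
     (\<forall>p q. \<forall>v\<in>I p q. vcnj v \<in> sumsp (I q p) (cspan (\<Union>{I r s |r s. r < q \<and> s < p})))"

definition deligne :: "(int \<Rightarrow> (complex^('n::finite)) set) \<Rightarrow> (int \<Rightarrow> (complex^('n::finite)) set) \<Rightarrow> int \<Rightarrow> int \<Rightarrow> (complex^('n::finite)) set" where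
  "deligne W F = (THE I. is_deligne W F I)"

definition gC_rs :: "(int \<Rightarrow> (complex^('n::finite)) set) \<Rightarrow> (int \<Rightarrow> (complex^('n::finite)) \<Rightarrow> (complex^('n::finite)) \<Rightarrow> complex) \<Rightarrow> (int \<Rightarrow> (complex^('n::finite)) set) \<Rightarrow> int \<Rightarrow> int \<Rightarrow> (complex^('n::finite)^'n) set" where
  "gC_rs W Q F r s = {X \<in> lie_gC W Q. \<forall>p q. \<forall>v\<in>deligne W F p q. X *v v \<in> deligne W F (p + r) (q + s)}"

text \<open>t_F = sum over r < 0 of g^(r,s)_C  (identified with T_F M).\<close>
definition tangent :: "(int \<Rightarrow> (complex^('n::finite)) set) \<Rightarrow> (int \<Rightarrow> (complex^('n::finite)) \<Rightarrow> (complex^('n::finite)) \<Rightarrow> complex) \<Rightarrow> (int \<Rightarrow> (complex^('n::finite)) set) \<Rightarrow> (complex^('n::finite)^'n) set" where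
  "tangent W Q F = {sum Y S |S Y. finite S \<and> (\<forall>rs\<in>S. fst rs < 0 \<and> Y rs \<in> gC_rs W Q F (fst rs) (snd rs))}"

definition sesquilinear :: "((complex^('n::finite)) \<Rightarrow> (complex^('n::finite)) \<Rightarrow> complex) \<Rightarrow> bool" where
  "sesquilinear h \<longleftrightarrow> (\<forall>u u' v. h (u + u') v = h u v + h u' v) \<and> (\<forall>u v v'. h u (v + v') = h u v + h u v') \<and>
     (\<forall>c u v. h (c *s u) v = c * h u v \<and> h u (c *s v) = cnj c * h u v)"

definition mh_metric :: "(int \<Rightarrow> (complex^('n::finite)) set) \<Rightarrow> (int \<Rightarrow> (complex^('n::finite)) \<Rightarrow> (complex^('n::finite)) \<Rightarrow> complex) \<Rightarrow> (int \<Rightarrow> (complex^('n::finite)) set) \<Rightarrow> (complex^('n::finite)) \<Rightarrow> (complex^('n::finite)) \<Rightarrow> complex" where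
  "mh_metric W Q F = (THE h. sesquilinear h \<and>
     (\<forall>p q p' q'. (p, q) \<noteq> (p', q') \<longrightarrow> (\<forall>u\<in>deligne W F p q. \<forall>v\<in>deligne W F p' q'. h u v = 0)) \<and>
     (\<forall>p q. \<forall>u\<in>deligne W F p q. \<forall>v\<in>deligne W F p q. h u v = \<i> powi (p - q) * Q (p + q) u (vcnj v)))"

definition mh_adjoint :: "(int \<Rightarrow> (complex^('n::finite)) set) \<Rightarrow> (int \<Rightarrow> (complex^('n::finite)) \<Rightarrow> (complex^('n::finite)) \<Rightarrow> complex) \<Rightarrow> (int \<Rightarrow> (complex^('n::finite)) set) \<Rightarrow> (complex^('n::finite)^'n) \<Rightarrow> (complex^('n::finite)^'n)" where
  "mh_adjoint W Q F A = (THE B. \<forall>u v. mh_metric W Q F (A *v u) v = mh_metric W Q F u (B *v v))"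

definition tangent_metric :: "(int \<Rightarrow> (complex^('n::finite)) set) \<Rightarrow> (int \<Rightarrow> (complex^('n::finite)) \<Rightarrow> (complex^('n::finite)) \<Rightarrow> complex) \<Rightarrow> (int \<Rightarrow> (complex^('n::finite)) set) \<Rightarrow> (complex^('n::finite)^'n) \<Rightarrow> (complex^('n::finite)^'n) \<Rightarrow> complex" where
  "tangent_metric W Q F \<alpha> \<beta> = trace (\<alpha> ** mh_adjoint W Q F \<beta>)"

definition act :: "(complex^('n::finite)^'n) \<Rightarrow> (int \<Rightarrow> (complex^('n::finite)) set) \<Rightarrow> (int \<Rightarrow> (complex^('n::finite)) set)" where
  "act g F = (\<lambda>p. (\<lambda>v. g *v v) ` F p)"

definition preserves :: "(complex^('n::finite)^'n) \<Rightarrow> (int \<Rightarrow> (complex^('n::finite)) set) \<Rightarrow> bool" where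
  "preserves Y F \<longleftrightarrow> (\<forall>p. \<forall>v\<in>F p. Y *v v \<in> F p)"

text \<open>Differential of L_g : F \<mapsto> g.F in the coordinates t_F = T_F M:
  d/dt g exp(tu).F = d/dt exp(t g u g^-1).(g.F), and the tangent vector at g.F
  of exp(tY).(g.F) depends only on Y modulo the stabilizer of g.F; L_g* u is
  the representative of g u g^-1 in t_(g.F).\<close>
definition Lstar :: "(int \<Rightarrow> (complex^('n::finite)) set) \<Rightarrow> (int \<Rightarrow> (complex^('n::finite)) \<Rightarrow> (complex^('n::finite)) \<Rightarrow> complex) \<Rightarrow> (complex^('n::finite)^'n) \<Rightarrow> (int \<Rightarrow> (complex^('n::finite)) set) \<Rightarrow> (complex^('n::finite)^'n) \<Rightarrow> (complex^('n::finite)^'n)" where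
  "Lstar W Q g F u = (THE u'. u' \<in> tangent W Q (act g F) \<and>
      preserves (g ** u ** matrix_inv g - u') (act g F))"

definition typeI :: "(int \<Rightarrow> (complex^('n::finite)) set) \<Rightarrow> (int \<Rightarrow> (complex^('n::finite)) \<Rightarrow> (complex^('n::finite)) \<Rightarrow> complex) \<Rightarrow> (int \<Rightarrow> nat) \<Rightarrow> bool" where
  "typeI W Q hdim \<longleftrightarrow> (\<exists>k. \<forall>F\<in>classifying_space W Q hdim. \<forall>p q.
      p + q \<notin> {k, k - 1} \<longrightarrow> deligne W F p q = {0})"

definition typeII :: "(int \<Rightarrow> (complex^('n::finite)) set) \<Rightarrow> (int \<Rightarrow> (complex^('n::finite)) \<Rightarrow> (complex^('n::finite)) \<Rightarrow> complex) \<Rightarrow> (int \<Rightarrow> nat) \<Rightarrow> bool" where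
  "typeII W Q hdim \<longleftrightarrow> (\<exists>k. \<forall>F\<in>classifying_space W Q hdim. \<forall>p q.
      p + q \<noteq> 2 * k - 1 \<and> (p, q) \<notin> {(k, k), (k - 1, k - 1)} \<longrightarrow> deligne W F p q = {0})"

end

theory Submission
  imports Defs
begin

text \<open>
  Deligne's bigrading \<open>V = \<Oplus> I\<^sup>p\<^sup>,\<^sup>q\<close> exists, is unique, and satisfies
  \<open>conj I\<^sup>p\<^sup>,\<^sup>q \<equiv> I\<^sup>q\<^sup>,\<^sup>p\<close> modulo \<open>W\<^sub>p\<^sub>+\<^sub>q\<^sub>-\<^sub>2\<close>.  Hence conjugation induces an antiunitary involution of the
  bigraded space that agrees with the true conjugation on every \<open>W\<^sub>k / W\<^sub>k\<^sub>-\<^sub>2\<close>.  Matching orthonormal bases of the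
  pieces \<open>I\<^sup>p\<^sup>,\<^sup>q\<close> of two filtrations, compatibly with these involutions, gives an element of \<open>H\<close>
  carrying one filtration to the other, provided that the Hodge numbers agree.  In types (I) and (II)
  the Hodge numbers are determined by \<open>dim F\<^sup>p\<close> and \<open>dim W\<^sub>k\<close>: in type (I) the difference
  of two solutions is invariant under both \<open>p \<mapsto> k - p\<close> and \<open>p \<mapsto> k - 1 - p\<close>, so it is constant with finite support.

  For \<open>g\<close> in \<open>H\<close> the subspaces \<open>g I\<^sup>p\<^sup>,\<^sup>q\<close> satisfy the conjugation condition modulo
  \<open>W\<^sub>p\<^sub>+\<^sub>q\<^sub>-\<^sub>2\<close>, which in types (I) and (II) is contained in the error term allowed for the Deligne bigrading.
  So \<open>g\<close> carries the bigrading of \<open>F\<close> to that of \<open>g F\<close>, hence also the mixed Hodge metric, and \<open>L\<^sub>g\<^sub>*\<close> is conjugation by \<open>g\<close>.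
\<close>

text \<open>True conjugation does not respect the bigrading, so it is replaced by its bigraded part
  \<open>bconj\<close>. In the conjugate of I^{p,q} the two differ by terms of type (r, s) with r <
  q and s < p, hence of weight at most p + q - 2; this is where the index 2 in H comes from. Q_k can
  be written back through the metric, \<open>bconj\<close> and the bigrading. A linear map
  respecting these three therefore preserves Q_k, and nothing about Q has to be arranged when bases
  are matched: the choice is free on I^{p,q} for p < q, then forced on I^{q,p}, and must be real on
  I^{p,p}. Bigrading, metric, adjoint and differential are given by definite descriptions. Each is
  shown to be uniquely determined, and the isometry statement then follows by transport: the image
  under g of each object satisfies the characterisation that belongs to g.F.\<close>

section \<open>Complex linear algebra\<close>

lemma cspan_eq_span: "cspan S = vec.span S"
  unfolding cspan_def vec.span_explicit by blast

lemma csubspace_eq_subspace: "csubspace S \<longleftrightarrow> vec.subspace S"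
  unfolding csubspace_def vec.subspace_def by blast

lemma cdim_eq_dim:
  assumes "vec.subspace S"
  shows "cdim S = vec.dim S"
proof -
  obtain B where B: "B \<subseteq> S" "vec.independent B" "S \<subseteq> vec.span B" "card B = vec.dim S"
    using vec.basis_exists by blast
  have fin: "finite B"
    using B vec.finiteI_independent by blast
  have "cspan B = S"
    unfolding cspan_eq_span using B assms vec.span_subspace by blast
  then show ?thesis
    unfolding cdim_def using B fin
    by (intro Least_equality) (auto simp: cspan_eq_span vec.dim_le_card)
qed

lemma vcnj_simps [simp]:
  "vcnj (u + v) = vcnj u + vcnj v"
  "vcnj (u - v) = vcnj u - vcnj v"
  "vcnj (- u) = - vcnj u"
  "vcnj (c *s u) = cnj c *s vcnj u"
  "vcnj (vcnj u) = u"
  "vcnj 0 = 0"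
  by (simp_all add: vcnj_def vec_eq_iff)

lemma vcnj_sum [simp]: "vcnj (sum f S) = (\<Sum>x\<in>S. vcnj (f x))"
  by (induction S rule: infinite_finite_induct) auto

lemma vcnj_rat_vec:
  assumes "rat_vec v" shows "vcnj v = v"
proof -
  have "cnj (v $ i) = v $ i" for i
  proof -
    obtain a b :: int where "v $ i = of_int a / of_int b"
      using assms Rats_cases'[of "v $ i"] unfolding rat_vec_def by metis
    then show ?thesis
      by simp
  qed
  then show ?thesis
    by (simp add: vcnj_def vec_eq_iff)
qed

lemma mem_cnjset: "x \<in> cnjset S \<longleftrightarrow> vcnj x \<in> S"
  unfolding cnjset_def by (metis imageE image_eqI vcnj_simps(5))

lemma subspace_vimage_vcnj: "vec.subspace S \<Longrightarrow> vec.subspace {v. vcnj v \<in> S}"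
  by (auto simp: vec.subspace_def)

text \<open>\<open>vcnj\<close> is antilinear, so dimension facts for linear images do not apply.
  Conjugating a basis gives a spanning set, hence one inequality; applying it to the conjugate set
  gives the other.\<close>

lemma dim_vcnj_image: "vec.dim (vcnj ` S) = vec.dim S"
proof -
  have le: "vec.dim (vcnj ` S) \<le> vec.dim S" for S :: "(complex^'n) set"
  proof -
    obtain B where B: "B \<subseteq> S" "vec.independent B" "S \<subseteq> vec.span B" "card B = vec.dim S"
      using vec.basis_exists by blast
    have fin: "finite B"
      using B vec.finiteI_independent by blast
    have "vec.span B \<subseteq> {v. vcnj v \<in> vec.span (vcnj ` B)}"
      by (intro vec.span_minimal subspace_vimage_vcnj vec.subspace_span)
        (auto intro: vec.span_base)
    then have "vcnj ` S \<subseteq> vec.span (vcnj ` B)"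
      using B by auto
    then have "vec.dim (vcnj ` S) \<le> card (vcnj ` B)"
      using fin by (intro vec.dim_le_card) auto
    also have "\<dots> \<le> card B"
      using fin by (rule card_image_le)
    finally show ?thesis
      using B by simp
  qed
  have "vcnj ` vcnj ` S = S"
    by (force simp: image_image)
  then show ?thesis
    using le[of S] le[of "vcnj ` S"] by simp
qed

lemma sesquilinear_sum:
  assumes "sesquilinear h"
  shows "h (sum f S) v = (\<Sum>x\<in>S. h (f x) v)" "h v (sum f S) = (\<Sum>x\<in>S. h v (f x))"
proof -
  have 0: "h 0 v = 0" "h v 0 = 0" for v
    using assms unfolding sesquilinear_def by (metis mult_zero_left vec.scale_zero_left complex_cnj_zero)+
  show "h (sum f S) v = (\<Sum>x\<in>S. h (f x) v)" "h v (sum f S) = (\<Sum>x\<in>S. h v (f x))"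
    using assms 0 by (induction S rule: infinite_finite_induct) (auto simp: sesquilinear_def)
qed

text \<open>Polarization: real values at u + v relate the imaginary parts of \<open>h u v\<close>
  and \<open>h v u\<close>, real values at u + i v their real parts.\<close>

lemma sesquilinear_hermitian:
  assumes h: "sesquilinear h" and re: "\<And>x. Im (h x x) = 0"
  shows "h u v = cnj (h v u)"
proof -
  have "h (u + v) (u + v) = h u u + h u v + h v u + h v v"
    "h (u + \<i> *s v) (u + \<i> *s v) = h u u - \<i> * h u v + \<i> * h v u + h v v"
    using h by (simp_all add: sesquilinear_def algebra_simps)
  then have "Im (h u v) + Im (h v u) = 0" "- Re (h u v) + Re (h v u) = 0"
    using re[of "u + v"] re[of "u + \<i> *s v"] re[of u] re[of v] by simp_all
  then show ?thesis
    by (simp add: complex_eq_iff)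
qed

text \<open>The exponents p - q + 2(p + q) and q - p differ by 4p. The identity combines the parity
  of \<open>Q\<close> with the factor in the metric when \<open>p\<close> and \<open>q\<close> trade
  places.\<close>

lemma i_powi_swap: "\<i> powi (p - q) * (-1) powi (p + q) = \<i> powi (q - p)"
proof -
  have "(-1 :: complex) = \<i> powi 2"
    by (simp add: power_int_def)
  then have "(-1 :: complex) powi (p + q) = \<i> powi (2 * (p + q))"
    by (simp only: power_int_mult)
  then have "\<i> powi (p - q) * (-1) powi (p + q) = \<i> powi (p - q + 2 * (p + q))"
    by (subst power_int_add) simp_all
  also have "p - q + 2 * (p + q) = (q - p) + 4 * p"
    by simp
  also have "\<i> powi ((q - p) + 4 * p) = \<i> powi (q - p) * (\<i> powi 4) powi p"
    by (subst power_int_add) (simp_all only: power_int_mult complex_i_not_zero simp_thms)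
  also have "\<i> powi 4 = 1"
    by (simp add: power_int_def eval_nat_numeral)
  finally show ?thesis
    by simp
qed

section \<open>Hermitian inner products: orthonormal bases, isometries, adjoints\<close>

definition inner_form :: "((complex^('n::finite)) \<Rightarrow> (complex^('n::finite)) \<Rightarrow> complex) \<Rightarrow> bool" where
  "inner_form h \<longleftrightarrow> sesquilinear h \<and> (\<forall>u v. h u v = cnj (h v u)) \<and> (\<forall>x. x \<noteq> 0 \<longrightarrow> Re (h x x) > 0)"

definition orthonormal :: "((complex^('n::finite)) \<Rightarrow> (complex^('n::finite)) \<Rightarrow> complex) \<Rightarrow> (complex^('n::finite)) set \<Rightarrow> bool" where
  "orthonormal h B \<longleftrightarrow> (\<forall>b\<in>B. \<forall>c\<in>B. h b c = (if b = c then 1 else 0))"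

lemma inner_formD:
  assumes "inner_form h"
  shows "sesquilinear h" "h u v = cnj (h v u)" "x \<noteq> 0 \<Longrightarrow> Re (h x x) > 0"
  using assms unfolding inner_form_def by blast+

lemma inner_form_simps:
  assumes "inner_form h"
  shows "h (u + v) w = h u w + h v w" "h w (u + v) = h w u + h w v"
    "h (c *s u) w = c * h u w" "h w (c *s u) = cnj c * h w u"
    "h 0 w = 0" "h w 0 = 0" "h (u - v) w = h u w - h v w"
proof -
  have s: "sesquilinear h"
    using assms by (simp add: inner_form_def)
  show a: "h (u + v) w = h u w + h v w" "h w (u + v) = h w u + h w v"
    "h (c *s u) w = c * h u w" "h w (c *s u) = cnj c * h w u" for u v w c
    using s by (auto simp: sesquilinear_def)
  show "h 0 w = 0" "h w 0 = 0"
    using a(3)[of 0 0 w] a(4)[of w 0 0] by simp_all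
  show "h (u - v) w = h u w - h v w"
    using a(1)[of "u - v" v w] by simp
qed

lemma orthonormal_coeff:
  assumes h: "inner_form h" and B: "finite B" "orthonormal h B" "b \<in> B"
  shows "h (\<Sum>x\<in>B. c x *s x) b = c b"
proof -
  have "sesquilinear h"
    using h by (simp add: inner_form_def)
  then have "h (\<Sum>x\<in>B. c x *s x) b = (\<Sum>x\<in>B. c x * h x b)"
    by (simp add: sesquilinear_sum inner_form_simps[OF h])
  also have "\<dots> = (\<Sum>x\<in>B. if x = b then c x else 0)"
    using B by (intro sum.cong) (auto simp: orthonormal_def)
  finally show ?thesis
    using B by simp
qed

lemma orthonormal_expansion:
  assumes h: "inner_form h" and B: "finite B" "orthonormal h B" and v: "v \<in> vec.span B"
  shows "v = (\<Sum>b\<in>B. h v b *s b)"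
proof -
  obtain c where c: "v = (\<Sum>b\<in>B. c b *s b)"
    using v B by (auto simp: vec.span_finite)
  then have "h v b = c b" if "b \<in> B" for b
    using orthonormal_coeff[OF h B that] by simp
  then show ?thesis
    using c by simp
qed

lemma orthonormal_independent:
  assumes h: "inner_form h" and B: "finite B" "orthonormal h B"
  shows "vec.independent B"
proof
  assume "vec.dependent B"
  then obtain c b where c: "b \<in> B" "c b \<noteq> 0" "(\<Sum>x\<in>B. c x *s x) = 0"
    using B by (auto simp: vec.dependent_finite)
  then show False
    using orthonormal_coeff[OF h B, of b c] inner_form_simps(5)[OF h] by simp
qed

text \<open>Used with \<open>R\<close> equal to \<open>A\<close> or to the fixed points of an
  antilinear involution, hence closed under real scalars only, which suffices for normalization.
  Subtracting an orthogonal projection may leave \<open>R\<close>; \<open>ext\<close> supplies a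
  replacement in \<open>R\<close> that is still orthogonal to \<open>B\<close>. So a largest
  orthonormal subset of \<open>R\<close> spans \<open>A\<close>.\<close>

lemma orthonormal_basis_within:
  assumes h: "inner_form h" and A: "vec.subspace A" and R: "R \<subseteq> A"
    and scale: "\<And>x r. x \<in> R \<Longrightarrow> complex_of_real r *s x \<in> R"
    and ext: "\<And>B w. B \<subseteq> R \<Longrightarrow> w \<in> A \<Longrightarrow> w \<noteq> 0 \<Longrightarrow> (\<And>b. b \<in> B \<Longrightarrow> h w b = 0) \<Longrightarrow>
      \<exists>w'\<in>R. w' \<noteq> 0 \<and> (\<forall>b\<in>B. h w' b = 0)"
  obtains B where "finite B" "B \<subseteq> R" "orthonormal h B" "vec.span B = A"
proof -
  let ?P = "\<lambda>B. finite B \<and> B \<subseteq> R \<and> orthonormal h B"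
  have "\<exists>B. ?P B \<and> (\<forall>C. ?P C \<longrightarrow> card C \<le> card B)"
  proof (rule ex_has_greatest_nat)
    show "?P {}"
      by (simp add: orthonormal_def)
    show "\<forall>C. ?P C \<longrightarrow> card C < Suc (vec.dim (UNIV :: (complex^'a) set))"
    proof (intro allI impI)
      fix C assume "?P C"
      then have "card C = vec.dim C"
        using orthonormal_independent[OF h, of C] vec.dim_eq_card_independent by metis
      also have "\<dots> \<le> vec.dim (UNIV :: (complex^'a) set)"
        by (rule vec.dim_subset) simp
      finally show "card C < Suc (vec.dim (UNIV :: (complex^'a) set))"
        by simp
    qed
  qed
  then obtain B where B: "finite B" "B \<subseteq> R" "orthonormal h B" and max: "\<And>C. ?P C \<Longrightarrow> card C \<le> card B"
    by blast
  have "A \<subseteq> vec.span B"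
  proof (rule ccontr)
    assume "\<not> A \<subseteq> vec.span B"
    then obtain v where v: "v \<in> A" "v \<notin> vec.span B"
      by blast
    define w where "w = v - (\<Sum>b\<in>B. h v b *s b)"
    have s: "(\<Sum>b\<in>B. h v b *s b) \<in> vec.span B"
      by (intro vec.span_sum vec.span_scale vec.span_base)
    have sA: "vec.span B \<subseteq> A"
      using B R A by (intro vec.span_minimal) auto
    have "w \<in> A" "w \<noteq> 0"
      using v s sA vec.subspace_diff[OF A] by (auto simp: w_def)
    moreover have "h w b = 0" if "b \<in> B" for b
      using orthonormal_coeff[OF h B(1,3) that, of "h v"] by (simp add: w_def inner_form_simps[OF h])
    ultimately obtain x where x: "x \<in> R" "x \<noteq> 0" "\<forall>b\<in>B. h x b = 0"
      using ext[OF B(2)] by blast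
    have pos: "Re (h x x) > 0" and im: "Im (h x x) = 0"
      using inner_formD(3)[OF h x(2)] arg_cong[OF inner_formD(2)[OF h, of x x], of Im] by simp_all
    define y where "y = complex_of_real (1 / sqrt (Re (h x x))) *s x"
    have xx: "h x x = complex_of_real (Re (h x x))"
      using im by (simp add: complex_eq_iff)
    define c where "c = 1 / sqrt (Re (h x x))"
    have "h y y = complex_of_real c * (complex_of_real c * h x x)"
      by (simp add: y_def c_def inner_form_simps[OF h])
    also have "\<dots> = complex_of_real (c * c * Re (h x x))"
      by (metis xx of_real_mult mult.assoc)
    also have "c * c * Re (h x x) = 1 / sqrt (Re (h x x)) * (1 / sqrt (Re (h x x))) * Re (h x x)"
      by (simp only: c_def)
    also have "1 / sqrt (Re (h x x)) * (1 / sqrt (Re (h x x))) * Re (h x x) = 1"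
      using pos by (simp add: field_simps)
    finally have yy: "h y y = 1"
      by simp
    have yb: "h y b = 0" "h b y = 0" if "b \<in> B" for b
    proof -
      show 1: "h y b = 0"
        using x that by (simp add: y_def inner_form_simps[OF h])
      show "h b y = 0"
        using 1 inner_formD(2)[OF h, of b y] by simp
    qed
    have "y \<notin> B"
      using yb yy by force
    moreover have "y \<in> R"
      unfolding y_def by (rule scale[OF x(1)])
    then have "?P (insert y B)"
      using B yy yb by (auto simp: orthonormal_def)
    ultimately show False
      using max[of "insert y B"] B by simp
  qed
  moreover have "vec.span B \<subseteq> A"
    using B R A by (intro vec.span_minimal) auto
  ultimately show ?thesis
    using that B by blast
qed

lemma orthonormal_basis_exists:
  assumes h: "inner_form h" and A: "vec.subspace A"
  shows "\<exists>B. finite B \<and> orthonormal h B \<and> vec.span B = A"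
  by (rule orthonormal_basis_within[OF h A order_refl]) (auto intro: vec.subspace_scale[OF A])

text \<open>Coordinates with respect to \<open>B\<close> are moved to \<open>B'\<close>. On the
  whole space \<open>g\<close> is the projection to the span of \<open>B\<close> followed by this
  transfer. The formula is exported because compatibility with involutions is later checked on
  coordinates.\<close>

lemma isometry_of_orthonormal:
  assumes h: "inner_form h" and h': "inner_form h'"
    and B: "finite B" "orthonormal h B" and B': "finite B'" "orthonormal h' B'" and card: "card B = card B'"
  shows "\<exists>\<beta> g. Vector_Spaces.linear (*s) (*s) g \<and> g = (\<lambda>u. \<Sum>b\<in>B. h u b *s \<beta> b) \<and> \<beta> ` B \<subseteq> B' \<and>
    (\<forall>u\<in>vec.span B. \<forall>v\<in>vec.span B. h' (g u) (g v) = h u v)"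
proof -
  obtain \<beta> where \<beta>: "bij_betw \<beta> B B'"
    using finite_same_card_bij[OF B(1) B'(1) card] by blast
  define g where "g = (\<lambda>u. \<Sum>b\<in>B. h u b *s \<beta> b)"
  have lin: "Vector_Spaces.linear (*s) (*s) g"
    by unfold_locales (auto simp: g_def inner_form_simps[OF h] vec.scale_left_distrib sum.distrib vec.scale_sum_right)
  have ses: "sesquilinear h" "sesquilinear h'"
    using h h' inner_formD(1) by auto
  have "h' (g u) (g v) = h u v" if "v \<in> vec.span B" for u v
  proof -
    have hb: "h' (\<beta> b) (\<beta> c) = (if b = c then 1 else 0)" if "b \<in> B" "c \<in> B" for b c
      using B'(2) \<beta> that unfolding orthonormal_def bij_betw_def by (metis image_eqI inj_onD)
    have "h' (g u) (g v) = (\<Sum>b\<in>B. h u b * (\<Sum>c\<in>B. cnj (h v c) * h' (\<beta> b) (\<beta> c)))"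
      unfolding g_def sesquilinear_sum(1)[OF ses(2)] inner_form_simps(3)[OF h']
      by (simp add: sesquilinear_sum(2)[OF ses(2)] inner_form_simps(4)[OF h'])
    also have "\<dots> = (\<Sum>b\<in>B. h u b * (\<Sum>c\<in>B. if c = b then cnj (h v c) else 0))"
      by (intro sum.cong arg_cong2[where f = "(*)"] refl) (auto simp: hb)
    also have "\<dots> = (\<Sum>b\<in>B. cnj (h v b) * h u b)"
      using B by (simp add: mult.commute)
    also have "\<dots> = h u (\<Sum>b\<in>B. h v b *s b)"
      by (simp add: sesquilinear_sum(2)[OF ses(1)] inner_form_simps(4)[OF h])
    finally show ?thesis
      using orthonormal_expansion[OF h B that] by simp
  qed
  then show ?thesis
    using lin \<beta> unfolding g_def bij_betw_def by blast
qed

lemma dim_span_orthonormal: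
  "inner_form h \<Longrightarrow> finite B \<Longrightarrow> orthonormal h B \<Longrightarrow> vec.dim (vec.span B) = card B"
  using orthonormal_independent vec.dim_span_eq_card_independent by blast

lemma subspace_isometry_exists:
  assumes h: "inner_form h" and h': "inner_form h'"
    and A: "vec.subspace A" and A': "vec.subspace A'" and dim: "vec.dim A = vec.dim A'"
  shows "\<exists>g. Vector_Spaces.linear (*s) (*s) g \<and> (\<forall>u\<in>A. g u \<in> A') \<and>
    (\<forall>u\<in>A. \<forall>v\<in>A. h' (g u) (g v) = h u v)"
proof -
  obtain B where B: "finite B" "orthonormal h B" "vec.span B = A"
    using orthonormal_basis_exists[OF h A] by blast
  obtain B' where B': "finite B'" "orthonormal h' B'" "vec.span B' = A'"
    using orthonormal_basis_exists[OF h' A'] by blast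
  have card: "card B = card B'"
    using dim_span_orthonormal[OF h B(1,2)] dim_span_orthonormal[OF h' B'(1,2)] B(3) B'(3) dim by simp
  obtain \<beta> g where g: "Vector_Spaces.linear (*s) (*s) g" "g = (\<lambda>u. \<Sum>b\<in>B. h u b *s \<beta> b)"
    "\<beta> ` B \<subseteq> B'" "\<forall>u\<in>vec.span B. \<forall>v\<in>vec.span B. h' (g u) (g v) = h u v"
    using isometry_of_orthonormal[OF h h' B(1,2) B'(1,2) card] by blast
  have "g u \<in> A'" for u
    unfolding g(2) using g(3) B'(3) vec.span_superset[of B'] by (intro vec.subspace_sum vec.subspace_scale A') auto
  then show ?thesis
    using g(1,4) B(3) by blast
qed

text \<open>An orthonormal basis of the fixed space of an antiunitary involution \<open>s\<close> is also a complex
  orthonormal basis, which makes the isometry compatible with the involutions.\<close>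

lemma real_orthonormal_basis:
  assumes h: "inner_form h" and A: "vec.subspace A"
    and s: "\<And>u v. s (u + v) = s u + s v" "\<And>c u. s (c *s u) = cnj c *s s u" "\<And>u. s (s u) = u"
    and sA: "\<And>u. u \<in> A \<Longrightarrow> s u \<in> A" and hs: "\<And>u v. h (s u) (s v) = h v u"
  obtains B where "finite B" "B \<subseteq> A" "\<And>b. b \<in> B \<Longrightarrow> s b = b" "orthonormal h B" "vec.span B = A"
proof -
  let ?R = "{x \<in> A. s x = x}"
  obtain B where "finite B" "B \<subseteq> ?R" "orthonormal h B" "vec.span B = A"
  proof (rule orthonormal_basis_within[OF h A, of ?R])
    fix B w assume B: "B \<subseteq> ?R" and w: "w \<in> A" "w \<noteq> 0" "\<And>b. b \<in> B \<Longrightarrow> h w b = 0"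
    have sw: "h (s w) b = 0" if "b \<in> B" for b
    proof -
      have "h (s w) b = h (s w) (s b)"
        using B that by auto
      also have "\<dots> = cnj (h w b)"
        using hs inner_formD(2)[OF h, of b w] by simp
      finally show ?thesis
        using w(3) that by simp
    qed
    show "\<exists>w'\<in>?R. w' \<noteq> 0 \<and> (\<forall>b\<in>B. h w' b = 0)"
    \<comment> \<open>The vector w + s w is fixed by s. If it vanishes then s w = - w, and
      antilinearity makes i w fixed instead.\<close>
    proof (cases "w + s w = 0")
      case False
      then show ?thesis
        using w sw sA by (intro bexI[of _ "w + s w"])
          (auto simp: inner_form_simps[OF h] s add.commute intro: vec.subspace_add[OF A])
    next
      case True
      then have "s w = - w"
        by (simp add: eq_neg_iff_add_eq_0 add.commute)
      then show ?thesis
        using w by (intro bexI[of _ "\<i> *s w"])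
          (auto simp: inner_form_simps[OF h] s intro: vec.subspace_scale[OF A])
    qed
  next
    fix x and r :: real assume "x \<in> ?R"
    then show "complex_of_real r *s x \<in> ?R"
      by (auto simp: s intro: vec.subspace_scale[OF A])
  qed auto
  then show ?thesis
    using that[of B] by blast
qed

lemma subspace_real_isometry_exists:
  assumes h: "inner_form h" and h': "inner_form h'"
    and A: "vec.subspace A" and A': "vec.subspace A'" and dim: "vec.dim A = vec.dim A'"
    and s: "\<And>u v. s (u + v) = s u + s v" "\<And>c u. s (c *s u) = cnj c *s s u" "\<And>u. s (s u) = u"
    and sA: "\<And>u. u \<in> A \<Longrightarrow> s u \<in> A" and hs: "\<And>u v. h (s u) (s v) = h v u"
    and s': "\<And>u v. s' (u + v) = s' u + s' v" "\<And>c u. s' (c *s u) = cnj c *s s' u" "\<And>u. s' (s' u) = u"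
    and sA': "\<And>u. u \<in> A' \<Longrightarrow> s' u \<in> A'" and hs': "\<And>u v. h' (s' u) (s' v) = h' v u"
  shows "\<exists>g. Vector_Spaces.linear (*s) (*s) g \<and> (\<forall>u\<in>A. g u \<in> A') \<and>
    (\<forall>u\<in>A. \<forall>v\<in>A. h' (g u) (g v) = h u v) \<and> (\<forall>u\<in>A. g (s u) = s' (g u))"
proof -
  obtain B where B: "finite B" "B \<subseteq> A" "\<And>b. b \<in> B \<Longrightarrow> s b = b" "orthonormal h B" "vec.span B = A"
    by (rule real_orthonormal_basis[OF h A s sA hs]) auto
  obtain B' where B': "finite B'" "B' \<subseteq> A'" "\<And>b. b \<in> B' \<Longrightarrow> s' b = b" "orthonormal h' B'" "vec.span B' = A'"
    by (rule real_orthonormal_basis[OF h' A' s' sA' hs']) auto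
  have card: "card B = card B'"
    using dim_span_orthonormal[OF h B(1,4)] dim_span_orthonormal[OF h' B'(1,4)] B(5) B'(5) dim by simp
  obtain \<beta> g where g: "Vector_Spaces.linear (*s) (*s) g" "g = (\<lambda>u. \<Sum>b\<in>B. h u b *s \<beta> b)"
    "\<beta> ` B \<subseteq> B'" "\<forall>u\<in>vec.span B. \<forall>v\<in>vec.span B. h' (g u) (g v) = h u v"
    using isometry_of_orthonormal[OF h h' B(1,4) B'(1,4) card] by blast
  have "g u \<in> A'" for u
    unfolding g(2) using g(3) B'(2) by (intro vec.subspace_sum vec.subspace_scale A') auto
  moreover have "g (s u) = s' (g u)" for u
  proof -
    have s'0: "s' 0 = 0"
      using s'(2)[of 0 0] by simp
    have s'_sum: "s' (sum f S) = (\<Sum>x\<in>S. s' (f x))" for f and S :: "(complex^'a) set"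
      by (induction S rule: infinite_finite_induct) (auto simp: s' s'0)
    \<comment> \<open>Since the basis vectors are fixed, \<open>s\<close> acts on coordinates by
      complex conjugation, and so does \<open>s'\<close> with respect to \<open>B'\<close>.\<close>
    have "h (s u) b = cnj (h u b)" if "b \<in> B" for b
    proof -
      have "h (s u) b = h (s u) (s b)"
        using B(3) that by simp
      then show ?thesis
        using hs inner_formD(2)[OF h, of b u] by simp
    qed
    then show ?thesis
      unfolding g(2) s'_sum by (intro sum.cong) (use g(3) B'(3) in \<open>auto simp: s'\<close>)
  qed
  ultimately show ?thesis
    using g(1,4) B(5) by blast
qed

lemma adjoint_unique_exists:
  assumes h: "inner_form h"
  shows "\<exists>!B. \<forall>u v. h (A *v u) v = h u (B *v v)"
proof (rule ex_ex1I)
  obtain B where B: "finite B" "orthonormal h B" "vec.span B = UNIV"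
    using orthonormal_basis_exists[OF h vec.subspace_UNIV] by blast
  \<comment> \<open>The coefficient is forced: if f is adjoint to A, then h (f v) b = cnj (h (A b)
    v) = h v (A b).\<close>
  define f where "f v = (\<Sum>b\<in>B. h v (A *v b) *s b)" for v
  have lin: "Vector_Spaces.linear (*s) (*s) f"
    by unfold_locales (auto simp: f_def inner_form_simps[OF h] vec.scale_left_distrib sum.distrib vec.scale_sum_right)
  have "h (A *v u) v = h u (matrix f *v v)" for u v
  proof -
    have "h u (matrix f *v v) = h u (\<Sum>b\<in>B. h v (A *v b) *s b)"
      by (simp add: matrix_works[OF lin] f_def)
    also have "\<dots> = (\<Sum>b\<in>B. cnj (h v (A *v b)) * h u b)"
      by (simp add: sesquilinear_sum(2)[OF inner_formD(1)[OF h]] inner_form_simps(4)[OF h])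
    also have "\<dots> = (\<Sum>b\<in>B. h u b * h (A *v b) v)"
      by (intro sum.cong refl) (metis inner_formD(2)[OF h] mult.commute)
    also have "\<dots> = h (A *v (\<Sum>b\<in>B. h u b *s b)) v"
      by (simp add: sesquilinear_sum(1)[OF inner_formD(1)[OF h]] inner_form_simps(3)[OF h]
          vec.linear_sum[OF matrix_vector_mul_linear_gen] vec.linear_scale[OF matrix_vector_mul_linear_gen])
    finally show ?thesis
      using orthonormal_expansion[OF h B(1,2), of u] B(3) by simp
  qed
  then show "\<exists>B. \<forall>u v. h (A *v u) v = h u (B *v v)"
    by blast
next
  fix B B' assume B: "\<forall>u v. h (A *v u) v = h u (B *v v)" and B': "\<forall>u v. h (A *v u) v = h u (B' *v v)"
  have "B *v v = B' *v v" for v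
  proof (rule ccontr)
    assume "B *v v \<noteq> B' *v v"
    then have pos: "Re (h (B *v v - B' *v v) (B *v v - B' *v v)) > 0"
      using inner_formD(3)[OF h] by simp
    have "h w (B *v v) = h w (B' *v v)" for w
      using B B' by metis
    moreover have "h w (x - y) = h w x - h w y" for w x y
      using inner_form_simps(2)[OF h, of w "x - y" y] by simp
    ultimately show False
      using pos by simp
  qed
  then show "B = B'"
    by (simp add: matrix_eq)
qed

section \<open>Bigradings\<close>

definition bsupp :: "(int \<Rightarrow> int \<Rightarrow> (complex^('n::finite)) set) \<Rightarrow> (int \<times> int) set" where
  "bsupp I = {(p, q). I p q \<noteq> {0}}"

text \<open>\<open>SOME\<close> picks a whole family of summands at once, which is then evaluated at
  (p, q). Outside the support the pieces are zero, so for a bigrading the family is unique.\<close>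

definition bcomp :: "(int \<Rightarrow> int \<Rightarrow> (complex^('n::finite)) set) \<Rightarrow> int \<Rightarrow> int \<Rightarrow> complex^'n \<Rightarrow> complex^'n" where
  "bcomp I p q v =
     (SOME f. (\<forall>a b. f a b \<in> I a b) \<and> v = (\<Sum>(a, b)\<in>bsupp I. f a b)) p q"

locale bigrading =
  fixes I :: "int \<Rightarrow> int \<Rightarrow> (complex^('n::finite)) set"
  assumes big: "is_bigrading I"
begin

lemma subspace_piece: "vec.subspace (I p q)"
  using big by (simp add: is_bigrading_def csubspace_eq_subspace)

lemma finite_bsupp: "finite (bsupp I)"
  using big by (simp add: is_bigrading_def bsupp_def)

lemma zero_piece [simp]: "0 \<in> I p q"
  using subspace_piece vec.subspace_0 by blast

lemma span_pieces: "vec.span (\<Union>p q. I p q) = UNIV"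
  using big by (simp add: is_bigrading_def cspan_eq_span)

lemma pieces_independent:
  assumes "finite S" "\<And>p q. (p, q) \<in> S \<Longrightarrow> f p q \<in> I p q" "(\<Sum>(p, q)\<in>S. f p q) = 0" "(p, q) \<in> S"
  shows "f p q = 0"
proof -
  have "\<forall>(p, q)\<in>S. case_prod f (p, q) \<in> I p q"
    using assms by auto
  then have "\<forall>x\<in>S. case_prod f x = 0"
    using big assms unfolding is_bigrading_def by blast
  then show ?thesis
    using assms by auto
qed

lemma not_bsupp: "(p, q) \<notin> bsupp I \<Longrightarrow> v \<in> I p q \<Longrightarrow> v = 0"
  by (auto simp: bsupp_def)

lemma decomposition_exists: "\<exists>f. (\<forall>a b. f a b \<in> I a b) \<and> v = (\<Sum>(a, b)\<in>bsupp I. f a b)"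
proof -
  let ?U = "{v. \<exists>f. (\<forall>a b. f a b \<in> I a b) \<and> v = (\<Sum>(a, b)\<in>bsupp I. f a b)}"
  have "vec.subspace ?U"
  proof (rule vec.subspaceI)
    show "0 \<in> ?U"
      by (auto intro!: exI[of _ "\<lambda>a b. 0"])
  next
    fix x y assume "x \<in> ?U" "y \<in> ?U"
    then obtain f g where "\<forall>a b. f a b \<in> I a b" "x = (\<Sum>(a, b)\<in>bsupp I. f a b)"
      "\<forall>a b. g a b \<in> I a b" "y = (\<Sum>(a, b)\<in>bsupp I. g a b)"
      by blast
    then show "x + y \<in> ?U"
      by (auto intro!: exI[of _ "\<lambda>a b. f a b + g a b"] vec.subspace_add subspace_piece
          simp: sum.distrib case_prod_unfold)
  next
    fix c x assume "x \<in> ?U"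
    then obtain f where "\<forall>a b. f a b \<in> I a b" "x = (\<Sum>(a, b)\<in>bsupp I. f a b)"
      by blast
    then show "c *s x \<in> ?U"
      by (auto intro!: exI[of _ "\<lambda>a b. c *s f a b"] vec.subspace_scale subspace_piece
          simp: vec.scale_sum_right case_prod_unfold)
  qed
  moreover have "(\<Union>p q. I p q) \<subseteq> ?U"
  proof clarify
    fix x p q assume x: "x \<in> I p q"
    let ?f = "\<lambda>a b. if (a, b) = (p, q) then x else 0"
    have "(\<Sum>(a, b)\<in>bsupp I. ?f a b) = (\<Sum>y\<in>bsupp I. if y = (p, q) then x else 0)"
      by (intro sum.cong) (auto split: if_splits)
    also have "\<dots> = x"
      using finite_bsupp not_bsupp[OF _ x] by (auto simp: sum.delta)
    finally show "\<exists>f. (\<forall>a b. f a b \<in> I a b) \<and> x = (\<Sum>(a, b)\<in>bsupp I. f a b)"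
      using x by (intro exI[of _ ?f]) auto
  qed
  ultimately have "vec.span (\<Union>p q. I p q) \<subseteq> ?U"
    by (intro vec.span_minimal)
  then show ?thesis
    using span_pieces by auto
qed

lemma bcomp_in [simp]: "bcomp I p q v \<in> I p q"
  and bcomp_sum: "(\<Sum>(a, b)\<in>bsupp I. bcomp I a b v) = v"
  using someI_ex[OF decomposition_exists[of v]] by (auto simp: bcomp_def)

lemma bcomp_outside: "(p, q) \<notin> bsupp I \<Longrightarrow> bcomp I p q v = 0"
  using not_bsupp[OF _ bcomp_in] by blast

text \<open>The set \<open>T\<close> need not be the support: both expansions are extended by zero
  to a common finite index set, and independence is applied to their difference.\<close>

lemma bcomp_unique:
  assumes f: "\<And>p q. (p, q) \<in> T \<Longrightarrow> f p q \<in> I p q" and T: "finite T"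
    and v: "v = (\<Sum>(p, q)\<in>T. f p q)"
  shows "bcomp I p q v = (if (p, q) \<in> T then f p q else 0)"
proof -
  let ?g = "\<lambda>p q. if (p, q) \<in> T then f p q else 0"
  let ?c = "\<lambda>p q. if (p, q) \<in> bsupp I then bcomp I p q v else 0"
  \<comment> \<open>Adding (p, q) covers an index outside both sets, where the claim is that the
    component is zero.\<close>
  let ?S = "insert (p, q) (bsupp I \<union> T)"
  have fin: "finite ?S"
    using T finite_bsupp by simp
  have "(\<Sum>(p, q)\<in>?S. ?g p q) = (\<Sum>(p, q)\<in>T. f p q)"
    using fin by (intro sum.mono_neutral_cong_right) auto
  moreover have "(\<Sum>(p, q)\<in>?S. ?c p q) = (\<Sum>(p, q)\<in>bsupp I. bcomp I p q v)"
    using fin by (intro sum.mono_neutral_cong_right) auto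
  ultimately have "(\<Sum>(p, q)\<in>?S. ?c p q - ?g p q) = 0"
    using v bcomp_sum[of v] by (simp add: sum_subtractf case_prod_unfold)
  then have "?c p q - ?g p q = 0"
    using fin f
    by (intro pieces_independent[of ?S "\<lambda>p q. ?c p q - ?g p q"])
      (auto intro!: vec.subspace_diff vec.subspace_neg subspace_piece)
  moreover have "?c p q = bcomp I p q v"
    using not_bsupp[of p q "bcomp I p q v"] by auto
  ultimately show ?thesis
    by simp
qed

lemma bcomp_add: "bcomp I p q (u + v) = bcomp I p q u + bcomp I p q v"
proof -
  have "u + v = (\<Sum>(p, q)\<in>bsupp I. bcomp I p q u + bcomp I p q v)"
    using bcomp_sum[of u] bcomp_sum[of v] by (simp add: sum.distrib case_prod_unfold)
  then show ?thesis
    by (subst bcomp_unique[OF _ finite_bsupp, of "\<lambda>p q. bcomp I p q u + bcomp I p q v"])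
      (auto intro!: vec.subspace_add subspace_piece simp: bcomp_outside)
qed

lemma bcomp_scale: "bcomp I p q (c *s v) = c *s bcomp I p q v"
proof -
  have "c *s v = (\<Sum>(p, q)\<in>bsupp I. c *s bcomp I p q v)"
    by (metis (mono_tags, lifting) bcomp_sum case_prod_unfold sum.cong vec.scale_sum_right)
  then show ?thesis
    by (subst bcomp_unique[OF _ finite_bsupp, of "\<lambda>p q. c *s bcomp I p q v"])
      (auto intro!: vec.subspace_scale subspace_piece simp: bcomp_outside)
qed

lemma linear_bcomp: "Vector_Spaces.linear (*s) (*s) (bcomp I p q)"
  by unfold_locales (auto simp: bcomp_add bcomp_scale)

lemma bcomp_simps:
  "bcomp I p q 0 = 0"
  "bcomp I p q (u - v) = bcomp I p q u - bcomp I p q v"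
  "bcomp I p q (- u) = - bcomp I p q u"
  "bcomp I p q (\<Sum>x\<in>S. f x) = (\<Sum>x\<in>S. bcomp I p q (f x))"
  using vec.linear_0[OF linear_bcomp] vec.linear_diff[OF linear_bcomp]
    vec.linear_neg[OF linear_bcomp] vec.linear_sum[OF linear_bcomp] by auto

lemma bcomp_piece:
  assumes "v \<in> I a b"
  shows "bcomp I p q v = (if (p, q) = (a, b) then v else 0)"
  using bcomp_unique[of "{(a, b)}" "\<lambda>_ _. v" v p q] assms by auto

lemma eq_zero_if_bcomp: "(\<And>p q. bcomp I p q v = 0) \<Longrightarrow> v = 0"
  using bcomp_sum[of v] by simp

lemma eq_if_bcomp: "(\<And>p q. bcomp I p q u = bcomp I p q v) \<Longrightarrow> u = v"
  using eq_zero_if_bcomp[of "u - v"] by (simp add: bcomp_simps)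

lemma piece_iff: "v \<in> I p q \<longleftrightarrow> (\<forall>a b. (a, b) \<noteq> (p, q) \<longrightarrow> bcomp I a b v = 0)"
proof (intro iffI)
  assume r: "\<forall>a b. (a, b) \<noteq> (p, q) \<longrightarrow> bcomp I a b v = 0"
  have "v = bcomp I p q v"
    by (rule eq_if_bcomp) (use r bcomp_piece[OF bcomp_in] in auto)
  then show "v \<in> I p q"
    by (metis bcomp_in)
qed (auto simp: bcomp_piece)

text \<open>This turns membership in F^p, in W_k and in the error term of the conjugation condition
  into vanishing of components.\<close>

lemma span_pieces_iff:
  "vec.span (\<Union>{I a b |a b. P a b}) = {v. \<forall>a b. \<not> P a b \<longrightarrow> bcomp I a b v = 0}"
    (is "?L = ?R")
proof
  have "vec.subspace ?R"
    by (auto simp: vec.subspace_def bcomp_simps bcomp_add bcomp_scale)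
  moreover have "\<Union>{I a b |a b. P a b} \<subseteq> ?R"
    by (auto simp: bcomp_piece)
  ultimately show "?L \<subseteq> ?R"
    by (intro vec.span_minimal)
next
  show "?R \<subseteq> ?L"
  proof
    fix v assume v: "v \<in> ?R"
    have "(\<Sum>(a, b)\<in>bsupp I. bcomp I a b v) \<in> ?L"
    proof (rule vec.span_sum, clarify)
      fix a b
      show "bcomp I a b v \<in> ?L"
      proof (cases "P a b")
        case True
        then show ?thesis
          by (intro vec.span_base) (auto intro!: exI[of _ "I a b"])
      next
        case False
        then show ?thesis
          using v vec.span_zero by auto
      qed
    qed
    then show "v \<in> ?L"
      by (simp add: bcomp_sum)
  qed
qed

lemma dim_span_pieces:
  assumes "finite T"
  shows "vec.dim (vec.span (\<Union>{I a b |a b. (a, b) \<in> T})) = (\<Sum>(a, b)\<in>T. vec.dim (I a b))"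
  using assms
proof induction
  case empty
  then show ?case
    by simp
next
  case (insert x T)
  obtain p q where x: "x = (p, q)"
    by force
  let ?U = "vec.span (\<Union>{I a b |a b. (a, b) \<in> T})"
  have "\<Union>{I a b |a b. (a, b) \<in> insert x T} = I p q \<union> \<Union>{I a b |a b. (a, b) \<in> T}"
    using x by auto
  then have eq: "vec.span (\<Union>{I a b |a b. (a, b) \<in> insert x T}) = {u + v |u v. u \<in> I p q \<and> v \<in> ?U}"
    by (simp add: vec.span_Un subspace_piece vec.span_eq_iff[THEN iffD2])
  have "v = 0" if "v \<in> I p q" "v \<in> ?U" for v
  proof (rule eq_zero_if_bcomp)
    fix a b
    show "bcomp I a b v = 0"
      using that insert.hyps x bcomp_piece[OF that(1)] unfolding span_pieces_iff
      by (auto split: if_splits)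
  qed
  then have "I p q \<inter> ?U = {0}"
    by (auto intro: vec.span_zero)
  then have "vec.dim (I p q \<inter> ?U) = 0"
    by simp
  then show ?case
    using vec.dim_sums_Int[OF subspace_piece[of p q] vec.subspace_span, of "\<Union>{I a b |a b. (a, b) \<in> T}"]
      insert eq x by (simp del: vec.dim_eq_0)
qed

lemma dim_span_pieces_Collect:
  "vec.dim (vec.span (\<Union>{I a b |a b. P a b})) = (\<Sum>(a, b)\<in>{x\<in>bsupp I. case_prod P x}. vec.dim (I a b))"
proof -
  have "vec.span (\<Union>{I a b |a b. P a b}) = vec.span (\<Union>{I a b |a b. (a, b) \<in> {x\<in>bsupp I. case_prod P x}})"
    unfolding span_pieces_iff by (auto dest: not_bsupp[OF _ bcomp_in])
  then show ?thesis
    using dim_span_pieces[of "{x\<in>bsupp I. case_prod P x}"] finite_bsupp by simp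
qed

end

section \<open>The Deligne bigrading\<close>

locale weight_filtered =
  fixes W :: "int \<Rightarrow> (complex^('n::finite)) set"
  assumes wf: "weight_filtration W"
begin

lemma subspace_W: "vec.subspace (W k)"
  using wf by (simp add: weight_filtration_def csubspace_eq_subspace)

lemma W_Suc: "W k \<subseteq> W (k + 1)"
  using wf by (simp add: weight_filtration_def)

lemma W_mono:
  assumes "k \<le> l" shows "W k \<subseteq> W l"
  using assms by (induction rule: int_ge_induct) (use W_Suc in auto)

lemma W_monoD: "v \<in> W k \<Longrightarrow> k \<le> l \<Longrightarrow> v \<in> W l"
  using W_mono by blast

lemma W_bounds:
  obtains a b where "\<And>k. k \<le> a \<Longrightarrow> W k = {0}" "\<And>k. b \<le> k \<Longrightarrow> W k = UNIV"
  using wf unfolding weight_filtration_def by blast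

lemma W_rational: "W k = vec.span (W k \<inter> {v. rat_vec v})"
  using wf unfolding weight_filtration_def cspan_eq_span by blast

text \<open>W_k is spanned by rational vectors, and these are fixed by \<open>vcnj\<close>.\<close>

lemma vcnj_W: assumes "v \<in> W k" shows "vcnj v \<in> W k"
proof -
  have "vec.span (W k \<inter> {v. rat_vec v}) \<subseteq> {v. vcnj v \<in> W k}"
    by (intro vec.span_minimal subspace_vimage_vcnj subspace_W) (auto simp: vcnj_rat_vec)
  then show ?thesis
    using assms W_rational[of k] by auto
qed

lemmas W_closed = vec.subspace_add[OF subspace_W] vec.subspace_diff[OF subspace_W]
  vec.subspace_scale[OF subspace_W] vec.subspace_neg[OF subspace_W] vec.subspace_0[OF subspace_W]

lemma Fgr_W: "v \<in> Fgr W F' k p \<Longrightarrow> v \<in> W k"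
  unfolding Fgr_def sumsp_def using W_closed(1) W_monoD[of _ "k - 1" k] by fastforce

lemma Fgr_add_low:
  assumes "v \<in> Fgr W F' k p" "w \<in> W (k - 1)"
  shows "v + w \<in> Fgr W F' k p"
  using assms W_closed(1)[of _ "k - 1" w] unfolding Fgr_def sumsp_def by (smt (verit) add.assoc mem_Collect_eq)

end

locale mixed_hodge = weight_filtered +
  fixes F :: "int \<Rightarrow> (complex^('n::finite)) set"
  assumes hf: "hodge_filtration F" and mhs: "is_MHS W F"
begin

lemma subspace_F: "vec.subspace (F k)"
  using hf by (simp add: hodge_filtration_def csubspace_eq_subspace)

lemma F_Suc: "F (k + 1) \<subseteq> F k"
  using hf by (simp add: hodge_filtration_def)

lemma F_mono:
  assumes "k \<le> l" shows "F l \<subseteq> F k"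
  using assms by (induction rule: int_ge_induct) (use F_Suc in auto)

lemma F_monoD: "v \<in> F l \<Longrightarrow> k \<le> l \<Longrightarrow> v \<in> F k"
  using F_mono by blast

lemma F_bounds:
  obtains a b where "\<And>k. k \<le> a \<Longrightarrow> F k = UNIV" "\<And>k. b \<le> k \<Longrightarrow> F k = {0}"
  using hf unfolding hodge_filtration_def by blast

lemmas F_closed = vec.subspace_add[OF subspace_F] vec.subspace_diff[OF subspace_F]
  vec.subspace_scale[OF subspace_F] vec.subspace_neg[OF subspace_F] vec.subspace_0[OF subspace_F]

text \<open>The spanning half of opposedness on Gr_k, pulled back to vectors of V. The indices p and
  k - p + 1 add up to k + 1, the count that every later use has to match.\<close>

lemma gr_split:
  assumes "w \<in> W k"
  obtains u v w' where "w = u + v + w'" "u \<in> F p" "u \<in> W k" "vcnj v \<in> F (k - p + 1)" "v \<in> W k" "w' \<in> W (k - 1)"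
proof -
  have "w \<in> sumsp (Fgr W F k p) (cnjset (Fgr W F k (k - p + 1)))"
    using mhs assms by (auto simp: is_MHS_def)
  then obtain x y where xy: "w = x + y" "x \<in> Fgr W F k p" "vcnj y \<in> Fgr W F k (k - p + 1)"
    by (auto simp: sumsp_def mem_cnjset)
  then obtain u x' v y' where "x = u + x'" "u \<in> F p" "u \<in> W k" "x' \<in> W (k - 1)"
    "vcnj y = v + y'" "v \<in> F (k - p + 1)" "v \<in> W k" "y' \<in> W (k - 1)"
    unfolding Fgr_def sumsp_def by blast
  moreover have "y = vcnj v + vcnj y'"
    using calculation(5) by (metis vcnj_simps(1,5))
  ultimately show ?thesis
    using that[of u "vcnj v" "x' + vcnj y'"] xy by (auto simp: vcnj_W W_closed)
qed

text \<open>The other half of opposedness: \<open>u\<close> and \<open>v\<close> represent one class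
  of Gr_k, common to F^p and conj F^{k-p+1}, hence zero.\<close>

lemma gr_disjoint:
  assumes "u \<in> F p" "u \<in> W k" "vcnj v \<in> F (k - p + 1)" "v \<in> W k" "u - v \<in> W (k - 1)"
  shows "u \<in> W (k - 1)"
proof -
  have "u \<in> Fgr W F k p"
    using assms W_closed(5) unfolding Fgr_def sumsp_def by force
  moreover have "vcnj u \<in> Fgr W F k (k - p + 1)"
  proof -
    have "vcnj u = vcnj v + vcnj (u - v)"
      by simp
    then show ?thesis
      using assms vcnj_W[of v k] vcnj_W[of "u - v" "k - 1"] unfolding Fgr_def sumsp_def by blast
  qed
  ultimately have "u \<in> Fgr W F k p \<inter> cnjset (Fgr W F k (k - p + 1))"
    by (simp add: mem_cnjset)
  then show ?thesis
    using mhs unfolding is_MHS_def by blast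
qed

text \<open>The error sum in Deligne's formula, for weight k and second index q. Its lower limit
  \<open>m\<close> is a parameter so that summands can be split off one weight at a time.\<close>

definition tail :: "int \<Rightarrow> int \<Rightarrow> int \<Rightarrow> (complex^'n) set" where
  "tail k q m = vec.span (\<Union>j\<in>{m..}. {v \<in> W (k - j). vcnj v \<in> F (q - j + 1)})"

text \<open>Deligne's formula
  \<open>I\<^sup>p\<^sup>,\<^sup>q = F\<^sup>p \<inter> W\<^sub>k \<inter> (conj F\<^sup>q \<inter> W\<^sub>k + \<Sum>\<^sub>j conj F\<^sup>q\<^sup>-\<^sup>j\<^sup>+\<^sup>1 \<inter> W\<^sub>k\<^sub>-\<^sub>j)\<close> with \<open>k = p + q\<close>.  The usual sum
  starts at \<open>j = 2\<close>; the term \<open>j = 1\<close> is contained in the first summand.\<close>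

definition upper :: "int \<Rightarrow> int \<Rightarrow> (complex^'n) set" where
  "upper p q = {a + e |a e. a \<in> W (p + q) \<and> vcnj a \<in> F q \<and> e \<in> tail (p + q) q 1}"

definition piece :: "int \<Rightarrow> int \<Rightarrow> (complex^'n) set" where
  "piece p q = F p \<inter> W (p + q) \<inter> upper p q"

lemma tail_split:
  assumes "x \<in> tail k q m"
  obtains a e where "x = a + e" "a \<in> W (k - m)" "vcnj a \<in> F (q - m + 1)" "e \<in> tail k q (m + 1)"
proof -
  have U: "(\<Union>j\<in>{m..}. {v \<in> W (k - j). vcnj v \<in> F (q - j + 1)}) =
      {v \<in> W (k - m). vcnj v \<in> F (q - m + 1)} \<union> (\<Union>j\<in>{m + 1..}. {v \<in> W (k - j). vcnj v \<in> F (q - j + 1)})"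
  proof -
    have "{m..} = insert m {m + 1..}"
      by auto
    then show ?thesis
      by simp
  qed
  have "vec.subspace {v \<in> W (k - m). vcnj v \<in> F (q - m + 1)}"
    using subspace_W[of "k - m"] subspace_F[of "q - m + 1"] by (auto simp: vec.subspace_def)
  then have "vec.span {v \<in> W (k - m). vcnj v \<in> F (q - m + 1)} = {v \<in> W (k - m). vcnj v \<in> F (q - m + 1)}"
    by (simp add: vec.span_eq_iff)
  then show ?thesis
    using assms that unfolding tail_def U vec.span_Un by blast
qed

lemma tail_W: "tail k q m \<subseteq> W (k - m)"
  unfolding tail_def by (intro vec.span_minimal subspace_W) (auto intro: W_monoD)

lemma tail_base: "v \<in> W (k - j) \<Longrightarrow> vcnj v \<in> F (q - j + 1) \<Longrightarrow> m \<le> j \<Longrightarrow> v \<in> tail k q m"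
  unfolding tail_def by (intro vec.span_base) auto

lemma subspace_tail: "vec.subspace (tail k q m)"
  unfolding tail_def by simp

lemma subspace_upper: "vec.subspace (upper p q)"
proof -
  have A: "vec.subspace {a. a \<in> W (p + q) \<and> vcnj a \<in> F q}"
    using subspace_W[of "p + q"] subspace_F[of q] by (auto simp: vec.subspace_def)
  have "upper p q = {x + y |x y. x \<in> {a. a \<in> W (p + q) \<and> vcnj a \<in> F q} \<and> y \<in> tail (p + q) q 1}"
    unfolding upper_def by auto
  then show ?thesis
    using vec.subspace_sums[OF A subspace_tail] by simp
qed

lemma subspace_deligne_piece: "vec.subspace (piece p q)"
  unfolding piece_def by (intro vec.subspace_inter subspace_F subspace_W subspace_upper)

lemma piece_F: "v \<in> piece p q \<Longrightarrow> v \<in> F p" and piece_W: "v \<in> piece p q \<Longrightarrow> v \<in> W (p + q)"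
  by (auto simp: piece_def)

text \<open>Descent through the weights, with k = p + q. Let u in W_{k-m} equal b + e with b in conj
  F^{q-m+1} and e in the tail from m + 1 on. In Gr_{k-m} the class of u lies in F^p and in conj
  F^{q-m+1}, whose indices add up to (k - m) + 1, so it is zero. The next summand of the tail joins
  b, and m grows until W_{k-m} = 0.\<close>

lemma piece_gr_injective:
  assumes u: "u \<in> piece p q" "u \<in> W (p + q - 1)"
  shows "u = 0"
proof -
  let ?k = "p + q"
  have uF: "u \<in> F p"
    using u piece_F by blast
  obtain v e where v: "u = v + e" "vcnj v \<in> F q" "e \<in> tail ?k q 1"
    using u by (auto simp: piece_def upper_def)
  obtain a e' where a: "e = a + e'" "a \<in> W (?k - 1)" "vcnj a \<in> F (q - 1 + 1)" "e' \<in> tail ?k q (1 + 1)"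
    using tail_split[OF v(3)] by blast
  have eW: "e \<in> W (?k - 1)"
    using v(3) tail_W[of ?k q 1] by auto
  \<comment> \<open>The j = 1 summand of the tail lies in conj F^q, as v does, so the two are merged
    and the descent can start at m = 1.\<close>
  have start: "\<exists>b e. u = b + e \<and> b \<in> W (?k - 1) \<and> vcnj b \<in> F (q - 1 + 1) \<and> e \<in> tail ?k q (1 + 1)"
  proof (rule exI[of _ "v + a"], rule exI[of _ e'], intro conjI)
    have "v \<in> W (?k - 1)"
      using eW u(2) v(1) W_closed(2)[of u "?k - 1" e] by simp
    then show "v + a \<in> W (?k - 1)"
      using a W_closed by blast
  qed (use v a F_closed in auto)
  have desc: "u \<in> W (?k - m) \<and> (\<exists>b e. u = b + e \<and> b \<in> W (?k - m) \<and> vcnj b \<in> F (q - m + 1) \<and> e \<in> tail ?k q (m + 1))"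
    if "1 \<le> m" for m
    using that
  proof (induction rule: int_ge_induct)
    case base
    then show ?case
      using start u(2) by simp
  next
    case (step m)
    then obtain b e where b: "u \<in> W (?k - m)" "u = b + e" "b \<in> W (?k - m)" "vcnj b \<in> F (q - m + 1)" "e \<in> tail ?k q (m + 1)"
      by blast
    have k: "?k - m - 1 = ?k - (m + 1)" "?k - m - p + 1 = q - m + 1"
      by simp_all
    have e: "e \<in> W (?k - (m + 1))"
      using b(5) tail_W[of ?k q "m + 1"] by blast
    have u': "u \<in> W (?k - (m + 1))"
      using gr_disjoint[OF uF b(1), of b] b e unfolding k by simp
    then have b': "b \<in> W (?k - (m + 1))"
      using b e W_closed(2)[of u "?k - (m + 1)" e] by simp
    obtain c e' where c: "e = c + e'" "c \<in> W (?k - (m + 1))" "vcnj c \<in> F (q - (m + 1) + 1)" "e' \<in> tail ?k q (m + 1 + 1)"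
      using tail_split[OF b(5)] by blast
    have "u = (b + c) + e'" "b + c \<in> W (?k - (m + 1))"
      using b c b' W_closed by (auto simp: add.assoc)
    moreover have "vcnj (b + c) \<in> F (q - (m + 1) + 1)"
      using c(3) F_monoD[OF b(4), of "q - (m + 1) + 1"] F_closed by simp
    ultimately show ?case
      using u' c(4) by blast
  qed
  obtain a b where a: "\<And>k. k \<le> a \<Longrightarrow> W k = {0}"
    using W_bounds by metis
  \<comment> \<open>\<open>max 1\<close> keeps m admissible for the descent, and m at least k - a
    puts k - m where W vanishes.\<close>
  show ?thesis
    using desc[of "max 1 (?k - a)"] a[of "?k - max 1 (?k - a)"] by auto
qed

text \<open>A class of type (p, q) in Gr_k is lifted by successive correction. The discrepancy w in
  W_{k-m} splits in Gr_{k-m} into a part in F^p, which is subtracted from the lift, and a part in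
  conj F^{q-m+1}, which is an admissible tail term; what remains has weight one less.\<close>

lemma piece_gr_surjective:
  assumes u: "u \<in> F p" "u \<in> W (p + q)" and v: "v \<in> W (p + q)" "vcnj v \<in> F q"
    and uv: "u - v \<in> W (p + q - 1)"
  obtains u' where "u' \<in> piece p q" "u' - u \<in> W (p + q - 1)"
proof -
  let ?k = "p + q"
  have ex: "\<exists>u' e w. u' \<in> F p \<and> u' - u \<in> W (?k - 1) \<and> u' = v + e + w \<and> e \<in> tail ?k q 1 \<and> w \<in> W (?k - m)"
    if "1 \<le> m" for m
    using that
  proof (induction rule: int_ge_induct)
    case base
    show ?case
      using u uv W_closed vec.subspace_0[OF subspace_tail]
      by (rule_tac exI[of _ u], rule_tac exI[of _ 0], rule_tac exI[of _ "u - v"]) auto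
  next
    case (step m)
    then obtain u' e w where 1: "u' \<in> F p" "u' - u \<in> W (?k - 1)" "u' = v + e + w" "e \<in> tail ?k q 1" "w \<in> W (?k - m)"
      by blast
    obtain a b w' where 2: "w = a + b + w'" "a \<in> F p" "a \<in> W (?k - m)" "vcnj b \<in> F (?k - m - p + 1)" "b \<in> W (?k - m)"
      "w' \<in> W (?k - m - 1)"
      using gr_split[OF 1(5)] .
    have k: "?k - m - 1 = ?k - (m + 1)" "?k - m - p + 1 = q - m + 1"
      by simp_all
    have "a \<in> W (?k - 1)"
      using 2(3) W_monoD step.hyps by simp
    then have "u' - u - a \<in> W (?k - 1)"
      using 1 W_closed by blast
    then have "u' - a - u \<in> W (?k - 1)"
      by (simp add: algebra_simps)
    moreover have "e + b \<in> tail ?k q 1"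
      using 1 2 k tail_base[of b ?k m q 1] step.hyps vec.subspace_add[OF subspace_tail] by simp
    moreover have "u' - a = v + (e + b) + w'"
      using 1 2 by simp
    moreover have "u' - a \<in> F p"
      using 1 2 F_closed by blast
    ultimately show ?case
      using 2(6) unfolding k by blast
  qed
  obtain c where c: "\<And>k. k \<le> c \<Longrightarrow> W k = {0}"
    using W_bounds by metis
  obtain u' e where u': "u' \<in> F p" "u' - u \<in> W (?k - 1)" "u' = v + e" "e \<in> tail ?k q 1"
    using ex[of "max 1 (?k - c)"] c[of "?k - max 1 (?k - c)"] by auto
  have "u' \<in> W ?k"
    using W_closed(1)[OF W_monoD[OF u'(2)] u(2)] by simp
  then have "u' \<in> piece p q"
    using u' v by (auto simp: piece_def upper_def)
  then show ?thesis
    using u' that by blast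
qed

text \<open>Upward induction on the weight and, inside it, downward induction on p. Modulo F^p, a
  vector of F^{p-1} has a class of pure type in the top graded piece; subtracting a lift of that
  class lowers the weight.\<close>

lemma F_inter_W_pieces:
  assumes "u \<in> F p" "u \<in> W k"
  shows "u \<in> vec.span (\<Union>{piece a b |a b. p \<le> a \<and> a + b \<le> k})"
proof -
  let ?S = "\<lambda>p k. vec.span (\<Union>{piece a b |a b. p \<le> a \<and> a + b \<le> k})"
  have mono: "?S p k \<subseteq> ?S p' k'" if "p' \<le> p" "k \<le> k'" for p k p' k'
    using that by (intro vec.span_mono Union_mono) force
  obtain c d where c: "\<And>k. k \<le> c \<Longrightarrow> W k = {0}" "\<And>k. d \<le> k \<Longrightarrow> W k = UNIV"
    using W_bounds by metis
  obtain c' d' where d: "\<And>k. k \<le> c' \<Longrightarrow> F k = UNIV" "\<And>k. d' \<le> k \<Longrightarrow> F k = {0}"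
    using F_bounds by metis
  have "\<forall>p. F p \<inter> W l \<subseteq> ?S p l" if "c \<le> l" for l
    using that
  proof (induction rule: int_ge_induct)
    case base
    then show ?case
      using c(1) by (auto intro: vec.span_zero)
  next
    case (step l)
    have "F p \<inter> W (l + 1) \<subseteq> ?S p (l + 1)" if "p \<le> d'" for p
      using that
    proof (induction rule: int_le_induct)
      case base
      then show ?case
        using d(2) by (auto intro: vec.span_zero)
    next
      case (step p)
      show ?case
      proof
        fix u assume u: "u \<in> F (p - 1) \<inter> W (l + 1)"
        then obtain b g w where 1: "u = b + g + w" "b \<in> F p" "b \<in> W (l + 1)"
          "vcnj g \<in> F (l + 1 - p + 1)" "g \<in> W (l + 1)" "w \<in> W (l + 1 - 1)"
          using gr_split[of u "l + 1" p] by blast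
        have bS: "b \<in> ?S (p - 1) (l + 1)"
          using 1 step.IH mono[of "p - 1" p "l + 1" "l + 1"] by auto
        \<comment> \<open>The partner of p - 1 in weight l + 1. As \<open>vcnj g\<close> lies in F
          of this index and g is congruent to u - b, the class of u - b has type (p - 1,
          ?q).\<close>
        let ?q = "l + 1 - p + 1"
        have k: "p - 1 + ?q = l + 1"
          by simp
        have ub: "u - b \<in> F (p - 1)" "u - b \<in> W (l + 1)"
          using u 1(2,3) F_monoD[OF 1(2), of "p - 1"] F_closed(2) W_closed(2) by auto
        obtain u' where u': "u' \<in> piece (p - 1) ?q" "u' - (u - b) \<in> W (p - 1 + ?q - 1)"
        proof (rule piece_gr_surjective[of "u - b" "p - 1" ?q g])
          show "u - b - g \<in> W (p - 1 + ?q - 1)"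
            using 1 by simp
          show "u - b \<in> W (p - 1 + ?q)" "g \<in> W (p - 1 + ?q)"
            unfolding k by (fact ub 1)+
        qed (use ub 1 in auto)
        have u'S: "u' \<in> ?S (p - 1) (l + 1)"
          using u'(1) k by (intro vec.span_base) force
        have "(u - b) - u' \<in> W l" 
          using W_closed(4)[OF u'(2)] by simp
        moreover have "(u - b) - u' \<in> F (p - 1)"
          using ub u'(1) piece_F F_closed by blast
        ultimately have "(u - b) - u' \<in> ?S (p - 1) l"
          using \<open>\<forall>p. F p \<inter> W l \<subseteq> ?S p l\<close> by blast
        then have "(u - b) - u' \<in> ?S (p - 1) (l + 1)"
          using mono[of "p - 1" "p - 1" l "l + 1"] by auto
        then have "b + u' + ((u - b) - u') \<in> ?S (p - 1) (l + 1)"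
          using bS u'S vec.span_add by blast
        then show "u \<in> ?S (p - 1) (l + 1)"
          by simp
      qed
    qed
    moreover have "F p \<inter> W (l + 1) \<subseteq> ?S p (l + 1)" if "d' \<le> p" for p
      using that d(2) by (auto intro: vec.span_zero)
    ultimately show ?case
      using linear[of _ d'] by blast
  qed
  moreover have "F p \<inter> W l \<subseteq> ?S p l" if "l \<le> c" for l p
    using that c(1) by (auto intro: vec.span_zero)
  ultimately show ?thesis
    using assms linear[of c k] by blast
qed

lemma F_eq_span_pieces: "F p = vec.span (\<Union>{piece a b |a b. p \<le> a})"
proof
  obtain d where "W d = UNIV"
    using W_bounds by (metis order_refl)
  then have "F p \<subseteq> vec.span (\<Union>{piece a b |a b. p \<le> a \<and> a + b \<le> d})"
    using F_inter_W_pieces[of _ p d] by auto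
  also have "\<dots> \<subseteq> vec.span (\<Union>{piece a b |a b. p \<le> a})"
    by (intro vec.span_mono) blast
  finally show "F p \<subseteq> vec.span (\<Union>{piece a b |a b. p \<le> a})" .
  show "vec.span (\<Union>{piece a b |a b. p \<le> a}) \<subseteq> F p"
    by (intro vec.span_minimal subspace_F) (auto dest!: piece_F intro: F_monoD)
qed

lemma W_eq_span_pieces: "W k = vec.span (\<Union>{piece a b |a b. a + b \<le> k})"
proof
  obtain d where "F d = UNIV"
    using F_bounds by (metis order_refl)
  then have "W k \<subseteq> vec.span (\<Union>{piece a b |a b. d \<le> a \<and> a + b \<le> k})"
    using F_inter_W_pieces[of _ d k] by auto
  also have "\<dots> \<subseteq> vec.span (\<Union>{piece a b |a b. a + b \<le> k})"
    by (intro vec.span_mono) blast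
  finally show "W k \<subseteq> vec.span (\<Union>{piece a b |a b. a + b \<le> k})" .
  show "vec.span (\<Union>{piece a b |a b. a + b \<le> k}) \<subseteq> W k"
    by (intro vec.span_minimal subspace_W) (auto dest!: piece_W intro: W_monoD)
qed

text \<open>Among the nonzero terms of a vanishing sum take the highest weight k and then the
  smallest p. Modulo W_{k-1} the term at (p, k - p) lies in conj F^{k-p} and, by the relation, in
  F^{p+1}. These indices add up to k + 1, so the term is in W_{k-1}, and
  \<open>piece_gr_injective\<close> makes it zero.\<close>

lemma deligne_pieces_independent:
  assumes S: "finite S" and f: "\<forall>(p, q)\<in>S. f (p, q) \<in> piece p q" and sum: "sum f S = 0"
  shows "\<forall>x\<in>S. f x = 0"
proof (rule ccontr)
  assume nz: "\<not> (\<forall>x\<in>S. f x = 0)"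
  define T where "T = {x\<in>S. f x \<noteq> 0}"
  have T: "finite T" "T \<noteq> {}" "sum f T = 0"
  proof -
    have "sum f T = sum f S"
      using S by (intro sum.mono_neutral_left) (auto simp: T_def)
    then show "sum f T = 0"
      using sum by simp
    show "finite T" "T \<noteq> {}"
      using S nz unfolding T_def by (simp, blast)
  qed
  define k where "k = Max ((\<lambda>(a, b). a + b) ` T)"
  have k: "a + b \<le> k" if "(a, b) \<in> T" for a b
    unfolding k_def using T that by (intro Max_ge) (auto intro!: image_eqI[of _ _ "(a, b)"])
  define p where "p = Min {a. (a, k - a) \<in> T}"
  have "{a. (a, k - a) \<in> T} \<subseteq> fst ` T"
    by force
  then have fin: "finite {a. (a, k - a) \<in> T}"
    using T finite_subset by blast
  have "k \<in> (\<lambda>(a, b). a + b) ` T"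
    unfolding k_def using T by (intro Max_in) auto
  then obtain a b where "(a, b) \<in> T" "k = a + b"
    by auto
  then have "(a, k - a) \<in> T"
    by simp
  then have "{a. (a, k - a) \<in> T} \<noteq> {}"
    by blast
  then have pT: "(p, k - p) \<in> T"
    using Min_in[OF fin] unfolding p_def by auto
  have p: "p \<le> a" if "(a, k - a) \<in> T" for a
    unfolding p_def using fin that by (intro Min_le) auto
  let ?f = "f (p, k - p)"
  let ?A = "{x\<in>T - {(p, k - p)}. fst x + snd x = k}"
  let ?B = "{x\<in>T - {(p, k - p)}. fst x + snd x \<noteq> k}"
  have fp: "f (a, b) \<in> piece a b" if "(a, b) \<in> T" for a b
    using that f by (auto simp: T_def)
  have "sum f T = ?f + sum f (T - {(p, k - p)})"
    using T pT by (simp add: sum.remove)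
  also have "sum f (T - {(p, k - p)}) = sum f ?A + sum f ?B"
  proof -
    have "sum f (T - {(p, k - p)}) = sum f (?A \<union> ?B)"
      by (rule arg_cong[of _ _ "sum f"]) blast
    also have "\<dots> = sum f ?A + sum f ?B"
      by (rule sum.union_disjoint) (use T in auto)
    finally show ?thesis .
  qed
  finally have eq: "?f + (sum f ?A + sum f ?B) = 0"
    using T by simp
  have AF: "sum f ?A \<in> F (p + 1)"
  proof (rule vec.subspace_sum[OF subspace_F])
    fix x assume "x \<in> ?A"
    then have "x = (fst x, k - fst x)" "x \<in> T" "x \<noteq> (p, k - p)"
      by (auto simp: prod_eq_iff)
    then obtain a where a: "x = (a, k - a)" "(a, k - a) \<in> T" "a \<noteq> p"
      by metis
    then have "p + 1 \<le> a"
      using p by force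
    then show "f x \<in> F (p + 1)"
      using a fp piece_F F_monoD by blast
  qed
  have AW: "sum f ?A \<in> W k"
  proof (rule vec.subspace_sum[OF subspace_W])
    fix x assume "x \<in> ?A"
    then show "f x \<in> W k"
      using fp[of "fst x" "snd x"] piece_W by force
  qed
  have BW: "sum f ?B \<in> W (k - 1)"
  proof (rule vec.subspace_sum[OF subspace_W])
    fix x assume "x \<in> ?B"
    then show "f x \<in> W (k - 1)"
      using fp[of "fst x" "snd x"] k[of "fst x" "snd x"] piece_W[of "f x" "fst x" "snd x"]
      by (auto intro: W_monoD)
  qed
  have fpp: "?f \<in> piece p (k - p)"
    using fp pT by blast
  then obtain v e where v: "?f = v + e" "v \<in> W k" "vcnj v \<in> F (k - p)" "e \<in> tail k (k - p) 1"
    by (auto simp: piece_def upper_def)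
  have e: "e \<in> W (k - 1)"
    using v(4) tail_W by blast
  have sA: "sum f ?A - (- v) = - sum f ?B - e"
  proof -
    have "sum f ?A + v + (sum f ?B + e) = 0"
      using eq unfolding v(1) by (simp add: ac_simps)
    then have "sum f ?A + v = - (sum f ?B + e)"
      by (simp only: eq_neg_iff_add_eq_0)
    then show ?thesis
      by simp
  qed
  have "sum f ?A - (- v) \<in> W (k - 1)"
    unfolding sA by (intro W_closed BW e)
  then have A: "sum f ?A \<in> W (k - 1)"
    using gr_disjoint[OF AF AW, of "- v"] v F_closed(4) W_closed(4) by simp
  have f_eq: "?f = - (sum f ?A + sum f ?B)"
    using eq by (simp only: eq_neg_iff_add_eq_0)
  have "?f \<in> W (k - 1)"
    unfolding f_eq by (intro W_closed A BW)
  then have "?f = 0"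
    using piece_gr_injective[OF fpp] by simp
  then show False
    using pT by (auto simp: T_def)
qed

lemma finite_piece_support: "finite {(p, q). piece p q \<noteq> {0}}"
proof -
  obtain c where c: "\<And>k. k \<le> c \<Longrightarrow> W k = {0}"
    using W_bounds by metis
  obtain d where d: "\<And>k. d \<le> k \<Longrightarrow> F k = {0}"
    using F_bounds by metis
  have 0: "0 \<in> piece p q" for p q
    using subspace_deligne_piece vec.subspace_0 by blast
  have "p < d \<and> q < d \<and> c < p + q" if nz: "piece p q \<noteq> {0}" for p q
  proof -
    obtain u where u: "u \<in> piece p q" "u \<noteq> 0"
      using nz 0 by blast
    have "\<not> d \<le> p" "\<not> p + q \<le> c"
      using u piece_F piece_W c d by blast+
    \<comment> \<open>If F^q = 0, Deligne's formula leaves only the tail, hence a vector of lower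
      weight, which must vanish.\<close>
    moreover have "\<not> d \<le> q"
    proof
      assume "d \<le> q"
      obtain v e where v: "u = v + e" "vcnj v \<in> F q" "e \<in> tail (p + q) q 1"
        using u by (auto simp: piece_def upper_def)
      then have "vcnj v = 0"
        using d \<open>d \<le> q\<close> by blast
      then have "v = 0"
        by (metis vcnj_simps(5,6))
      then have "u \<in> W (p + q - 1)"
        using v tail_W by auto
      then show False
        using piece_gr_injective u by blast
    qed
    ultimately show ?thesis
      by simp
  qed
  then have "{(p, q). piece p q \<noteq> {0}} \<subseteq> {c - d..d} \<times> {c - d..d}"
    by force
  then show ?thesis
    by (rule finite_subset) auto
qed

lemma is_bigrading_piece: "is_bigrading piece"
proof -
  have "vec.span (\<Union>p q. piece p q) = UNIV"
  proof -
    obtain d where d: "F d = UNIV"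
      using F_bounds by (metis order_refl)
    have "vec.span (\<Union>{piece a b |a b. d \<le> a}) \<subseteq> vec.span (\<Union>p q. piece p q)"
      by (intro vec.span_mono) blast
    then show ?thesis
      using F_eq_span_pieces[of d] d by auto
  qed
  then show ?thesis
    unfolding is_bigrading_def cspan_eq_span csubspace_eq_subspace
    using subspace_deligne_piece finite_piece_support deligne_pieces_independent by blast
qed

text \<open>An index shift: with j = (p + q) - (r + s) the weights agree, and r < q gives p - j + 1
  \<le> s, so conj F^s lies in conj F^{p-j+1}. Terms of the tail of (r, s) have the same shift added
  to their index.\<close>

lemma piece_subset_tail:
  assumes "x \<in> piece r s" "r < q" "s < p"
  shows "x \<in> tail (q + p) p 1"
proof -
  obtain a e where x: "x = a + e" "a \<in> W (r + s)" "vcnj a \<in> F s" "e \<in> tail (r + s) s 1"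
    using assms by (auto simp: piece_def upper_def)
  have "a \<in> tail (q + p) p 1"
    using x(2,3) assms by (intro tail_base[of _ _ "q + p - r - s"]) (auto intro: F_monoD)
  moreover have "tail (r + s) s 1 \<subseteq> tail (q + p) p 1"
    unfolding tail_def[of "r + s"]
  proof (intro vec.span_minimal subspace_tail, clarify)
    fix v and j :: int assume "1 \<le> j" "v \<in> W (r + s - j)" "vcnj v \<in> F (s - j + 1)"
    then show "v \<in> tail (q + p) p 1"
      using assms by (intro tail_base[of _ _ "q + p - r - s + j"]) (auto intro: F_monoD W_monoD)
  qed
  ultimately show ?thesis
    using x vec.subspace_add[OF subspace_tail] by blast
qed

text \<open>The components of \<open>vcnj u\<close> that should vanish add up to a vector \<open>y\<close> that again satisfies
  Deligne's formula for \<open>(q, p)\<close>; since the \<open>(q, p)\<close> component of \<open>y\<close> is zero, \<open>y = 0\<close>.\<close>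

lemma vcnj_piece:
  assumes u: "u \<in> piece p q"
  shows "vcnj u \<in> sumsp (piece q p) (vec.span (\<Union>{piece r s |r s. r < q \<and> s < p}))"
proof -
  interpret bigrading piece
    by unfold_locales (rule is_bigrading_piece)
  have F_zero: "bcomp piece a b v = 0" if "v \<in> F m" "a < m" for a b v m
    using that F_eq_span_pieces[of m] span_pieces_iff[of "\<lambda>a b. m \<le> a"] by force
  have W_zero: "bcomp piece a b v = 0" if "v \<in> W m" "m < a + b" for a b v m
    using that W_eq_span_pieces[of m] span_pieces_iff[of "\<lambda>a b. a + b \<le> m"] by force
  let ?c = "\<lambda>r s. bcomp piece r s (vcnj u)"
  obtain v e where v: "u = v + e" "v \<in> W (p + q)" "vcnj v \<in> F q" "e \<in> tail (p + q) q 1"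
    using u by (auto simp: piece_def upper_def)
  have e: "bcomp piece r s (vcnj e) = 0" if "p \<le> s" for r s
  proof -
    have "tail (p + q) q 1 \<subseteq> {x. bcomp piece r s (vcnj x) = 0}"
      unfolding tail_def
    proof (intro vec.span_minimal)
      show "vec.subspace {x. bcomp piece r s (vcnj x) = 0}"
        by (auto simp: vec.subspace_def bcomp_simps bcomp_add bcomp_scale)
      show "(\<Union>j\<in>{1..}. {v \<in> W (p + q - j). vcnj v \<in> F (q - j + 1)}) \<subseteq> {x. bcomp piece r s (vcnj x) = 0}"
      proof clarify
        fix j :: int and x assume j: "1 \<le> j" and x: "x \<in> W (p + q - j)" "vcnj x \<in> F (q - j + 1)"
        \<comment> \<open>For s \<ge> p, the bound r + s \<le> p + q - j would force r \<le> q - j;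
          so either the weight or the Hodge filtration kills the component.\<close>
        then have "p + q - j < r + s \<or> r < q - j + 1"
          using that by linarith
        then show "bcomp piece r s (vcnj x) = 0"
          using F_zero[OF x(2)] W_zero[OF vcnj_W[OF x(1)]] by blast
      qed
    qed
    then show ?thesis
      using v(4) by blast
  qed
  have zero: "?c r s = 0" if "r < q" "p \<le> s" for r s
    using F_zero[OF v(3) that(1)] e[OF that(2)] unfolding v(1) by (simp add: bcomp_add)
  let ?low = "{(r, s) \<in> bsupp piece. r < q \<and> s < p}"
  let ?rest = "{(r, s) \<in> bsupp piece. \<not> (r < q \<and> s < p) \<and> (r, s) \<noteq> (q, p)}"
  let ?L = "\<Sum>(r, s)\<in>?low. ?c r s"
  let ?y = "\<Sum>(r, s)\<in>?rest. ?c r s"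
  have fin: "finite ?low" "finite ?rest"
    using finite_bsupp by (auto intro: finite_subset)
  have split: "vcnj u = ?c q p + ?L + ?y"
  proof -
    have "vcnj u = (\<Sum>(r, s)\<in>bsupp piece. ?c r s)"
      by (simp add: bcomp_sum)
    also have "\<dots> = (\<Sum>(r, s)\<in>insert (q, p) (?low \<union> ?rest). ?c r s)"
      using fin by (intro sum.mono_neutral_left) (auto simp: bcomp_outside)
    also have "\<dots> = ?c q p + (\<Sum>(r, s)\<in>?low \<union> ?rest. ?c r s)"
      using fin by (subst sum.insert) auto
    also have "(\<Sum>(r, s)\<in>?low \<union> ?rest. ?c r s) = ?L + ?y"
      using fin by (intro sum.union_disjoint) auto
    finally show ?thesis
      by (simp add: add.assoc)
  qed
  have "?L \<in> tail (q + p) p 1"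
    by (rule vec.subspace_sum[OF subspace_tail]) (auto intro: piece_subset_tail[OF bcomp_in])
  then have L: "?L \<in> upper q p"
    unfolding upper_def mem_Collect_eq using W_closed(5) F_closed(5)
    by (rule_tac x = 0 in exI, rule_tac x = ?L in exI) simp
  have "vcnj u \<in> upper q p"
    unfolding upper_def using piece_F[OF u] vcnj_W[OF piece_W[OF u]] vec.subspace_0[OF subspace_tail]
    by (force simp: add.commute)
  moreover have "?c q p \<in> upper q p"
    using bcomp_in[of q p "vcnj u"] unfolding piece_def by blast
  ultimately have "vcnj u - ?c q p - ?L \<in> upper q p"
    using L vec.subspace_diff[OF subspace_upper] by blast
  moreover have "?y = vcnj u - ?c q p - ?L"
    using split[symmetric] by (simp only: eq_diff_eq ac_simps)
  ultimately have "?y \<in> upper q p"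
    by metis
  \<comment> \<open>Indices with r < q in the remaining sum have s \<ge> p, where the component is
    already known to vanish.\<close>
  moreover have "?y \<in> F q"
  proof (rule vec.subspace_sum[OF subspace_F])
    fix x assume "x \<in> ?rest"
    then obtain r s where x: "x = (r, s)" and rs: "\<not> (r < q \<and> s < p)"
      by blast
    have "?c r s \<in> F q"
    proof (cases "q \<le> r")
      case True
      then show ?thesis
        using piece_F[OF bcomp_in] F_monoD by blast
    next
      case False
      then show ?thesis
        using rs zero[of r s] F_closed(5) by simp
    qed
    then show "(case x of (r, s) \<Rightarrow> ?c r s) \<in> F q"
      by (simp add: x)
  qed
  moreover have "?y \<in> W (q + p)"
  proof (rule vec.subspace_sum[OF subspace_W])
    fix x
    have "?c r s \<in> W (q + p)" for r s
    proof (cases "r + s \<le> q + p")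
      case True
      then show ?thesis
        using piece_W[OF bcomp_in] W_monoD by blast
    next
      case False
      then show ?thesis
        using W_zero[OF vcnj_W[OF piece_W[OF u]], of r s] W_closed(5) by (simp add: add.commute)
    qed
    then show "(case x of (r, s) \<Rightarrow> ?c r s) \<in> W (q + p)"
      by (simp add: case_prod_unfold)
  qed
  ultimately have "?y \<in> piece q p"
    by (simp add: piece_def)
  then have "bcomp piece q p ?y = ?y"
    by (simp add: bcomp_piece)
  moreover have "bcomp piece q p ?y = 0"
    using fin by (subst bcomp_unique[of ?rest ?c]) auto
  ultimately have "vcnj u = ?c q p + ?L"
    using split by simp
  moreover have "?L \<in> vec.span (\<Union>{piece r s |r s. r < q \<and> s < p})"
    by (rule vec.span_sum) (use bcomp_in in \<open>force intro: vec.span_base\<close>)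
  ultimately show ?thesis
    unfolding sumsp_def using bcomp_in by blast
qed

lemma is_deligne_piece: "is_deligne W F piece"
  unfolding is_deligne_def cspan_eq_span
  using is_bigrading_piece F_eq_span_pieces W_eq_span_pieces vcnj_piece by blast

text \<open>The conjugation condition forces each piece of \<open>J\<close> into Deligne's formula,
  the error terms becoming tail terms with j = p + q - r - s. Given this inclusion, a decomposition
  along \<open>J\<close> is also one along \<open>piece\<close>, and uniqueness of components gives
  equality.\<close>

lemma is_deligne_unique:
  assumes J: "is_deligne W F J"
  shows "J = piece"
proof -
  interpret P: bigrading piece
    by unfold_locales (rule is_bigrading_piece)
  interpret J: bigrading J
    using J by unfold_locales (simp add: is_deligne_def)
  have JF: "v \<in> F m" if "v \<in> J p q" "m \<le> p" for v m p q
  proof -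
    have "v \<in> vec.span (\<Union>{J a b |a b. m \<le> a})"
      using that by (intro vec.span_base) blast
    then show ?thesis
      using J unfolding is_deligne_def cspan_eq_span by blast
  qed
  have JW: "v \<in> W m" if "v \<in> J p q" "p + q \<le> m" for v m p q
  proof -
    have "v \<in> vec.span (\<Union>{J a b |a b. a + b \<le> m})"
      using that by (intro vec.span_base) blast
    then show ?thesis
      using J unfolding is_deligne_def cspan_eq_span by blast
  qed
  have sub: "v \<in> piece p q" if v: "v \<in> J p q" for v p q
  proof -
    obtain a e where a: "vcnj v = a + e" "a \<in> J q p" "e \<in> vec.span (\<Union>{J r s |r s. r < q \<and> s < p})"
      using J v unfolding is_deligne_def cspan_eq_span sumsp_def by blast
    have "vec.span (\<Union>{J r s |r s. r < q \<and> s < p}) \<subseteq> {x. vcnj x \<in> tail (p + q) q 1}"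
    proof (intro vec.span_minimal subspace_vimage_vcnj subspace_tail, clarify)
      fix x r s assume x: "x \<in> J r s" "r < q" "s < p"
      show "vcnj x \<in> tail (p + q) q 1"
        using x by (intro tail_base[of _ _ "p + q - r - s"]) (auto intro: vcnj_W JW JF)
    qed
    then have "vcnj e \<in> tail (p + q) q 1"
      using a(3) by blast
    moreover have "vcnj (vcnj a) \<in> F q" "vcnj a \<in> W (p + q)"
      using JF[OF a(2)] JW[OF a(2)] vcnj_W by (auto simp: add.commute)
    moreover have "v = vcnj a + vcnj e"
      using a(1) by (metis vcnj_simps(1,5))
    ultimately have "v \<in> upper p q"
      unfolding upper_def by blast
    then show ?thesis
      using JF[OF v] JW[OF v] by (simp add: piece_def)
  qed
  have "v \<in> J p q" if v: "v \<in> piece p q" for v p q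
  proof -
    have "bcomp piece a b v = bcomp J a b v" for a b
      using P.bcomp_unique[OF _ J.finite_bsupp, of "\<lambda>a b. bcomp J a b v" v a b] sub[OF J.bcomp_in] J.bcomp_sum[of v]
      by (auto simp: J.bcomp_outside)
    then show ?thesis
      using P.bcomp_piece[OF v] J.piece_iff[of v p q] by metis
  qed
  then show ?thesis
    using sub by (intro ext) blast
qed

lemma is_deligne_deligne: "is_deligne W F (deligne W F)"
  unfolding deligne_def by (rule theI[of _ piece]) (fact is_deligne_piece is_deligne_unique)+

lemma deligne_eq: "is_deligne W F J \<Longrightarrow> deligne W F = J"
  using is_deligne_unique is_deligne_deligne by metis

end

section \<open>The mixed Hodge metric\<close>

locale polarized_mhs = mixed_hodge W F
  for W F :: "int \<Rightarrow> (complex^('n::finite)) set" +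
  fixes Q :: "int \<Rightarrow> complex^'n \<Rightarrow> complex^'n \<Rightarrow> complex"
  assumes gf: "graded_forms W Q" and pol: "graded_polarized W Q F"
begin

abbreviation I :: "int \<Rightarrow> int \<Rightarrow> (complex^'n) set" where
  "I \<equiv> deligne W F"

abbreviation cmp :: "int \<Rightarrow> int \<Rightarrow> complex^'n \<Rightarrow> complex^'n" where
  "cmp \<equiv> bcomp I"

sublocale bigrading "deligne W F"
  using is_deligne_deligne by unfold_locales (simp add: is_deligne_def)

lemma F_iff: "v \<in> F m \<longleftrightarrow> (\<forall>a b. a < m \<longrightarrow> cmp a b v = 0)"
proof -
  have "F m = {v. \<forall>a b. \<not> m \<le> a \<longrightarrow> cmp a b v = 0}"
    using is_deligne_deligne span_pieces_iff[of "\<lambda>a b. m \<le> a"]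
    unfolding is_deligne_def cspan_eq_span by auto
  then show ?thesis
    by (auto simp: not_le)
qed

lemma W_iff: "v \<in> W m \<longleftrightarrow> (\<forall>a b. m < a + b \<longrightarrow> cmp a b v = 0)"
proof -
  have "W m = {v. \<forall>a b. \<not> a + b \<le> m \<longrightarrow> cmp a b v = 0}"
    using is_deligne_deligne span_pieces_iff[of "\<lambda>a b. a + b \<le> m"]
    unfolding is_deligne_def cspan_eq_span by auto
  then show ?thesis
    by (auto simp: not_le)
qed

lemma cmp_vcnj:
  assumes "v \<in> I p q" "(r, s) \<noteq> (q, p)" "\<not> (r < q \<and> s < p)"
  shows "cmp r s (vcnj v) = 0"
proof -
  obtain a e where a: "vcnj v = a + e" "a \<in> I q p" "e \<in> vec.span (\<Union>{I r s |r s. r < q \<and> s < p})"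
    using is_deligne_deligne assms unfolding is_deligne_def cspan_eq_span sumsp_def by blast
  then show ?thesis
    using assms unfolding span_pieces_iff by (auto simp: bcomp_add bcomp_piece)
qed

lemma I_F: "v \<in> I p q \<Longrightarrow> v \<in> F p"
  by (auto simp: F_iff bcomp_piece)

lemma I_W: "v \<in> I p q \<Longrightarrow> v \<in> W (p + q)"
  by (auto simp: W_iff bcomp_piece)

lemma cmp_W [simp]: "cmp p q v \<in> W (p + q)" "vcnj (cmp p q v) \<in> W (p + q)"
  using I_W vcnj_W bcomp_in by blast+

section \<open>The graded forms as functions of classes in Gr\<close>

lemma Q_add_left: "u \<in> W k \<Longrightarrow> u' \<in> W k \<Longrightarrow> v \<in> W k \<Longrightarrow> Q k (u + u') v = Q k u v + Q k u' v"
  and Q_add_right: "u \<in> W k \<Longrightarrow> v \<in> W k \<Longrightarrow> v' \<in> W k \<Longrightarrow> Q k u (v + v') = Q k u v + Q k u v'"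
  and Q_scale_left: "u \<in> W k \<Longrightarrow> v \<in> W k \<Longrightarrow> Q k (c *s u) v = c * Q k u v"
  and Q_scale_right: "u \<in> W k \<Longrightarrow> v \<in> W k \<Longrightarrow> Q k u (c *s v) = c * Q k u v"
  and Q_low_left: "u \<in> W (k - 1) \<Longrightarrow> v \<in> W k \<Longrightarrow> Q k u v = 0"
  and Q_low_right: "u \<in> W (k - 1) \<Longrightarrow> v \<in> W k \<Longrightarrow> Q k v u = 0"
  and Q_parity: "u \<in> W k \<Longrightarrow> v \<in> W k \<Longrightarrow> Q k v u = (-1) powi k * Q k u v"
  and Q_rat: "u \<in> W k \<Longrightarrow> v \<in> W k \<Longrightarrow> rat_vec u \<Longrightarrow> rat_vec v \<Longrightarrow> Q k u v \<in> \<rat>"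
  using gf unfolding graded_forms_def by blast+

lemma Q_cong:
  assumes "u \<in> W k" "v \<in> W k" "u' - u \<in> W (k - 1)" "v' - v \<in> W (k - 1)"
  shows "Q k u' v' = Q k u v"
proof -
  have W: "u' - u \<in> W k" "v' - v \<in> W k"
    using assms W_monoD[of _ "k - 1" k] by auto
  have "Q k (u + (u' - u)) (v + (v' - v)) = Q k u v"
    using assms W by (simp only: Q_add_left Q_add_right Q_low_left Q_low_right W_closed(1) add_0_right)
  then show ?thesis
    by simp
qed

lemma Q_zero: "v \<in> W k \<Longrightarrow> Q k 0 v = 0" "v \<in> W k \<Longrightarrow> Q k v 0 = 0"
  using Q_low_left Q_low_right W_closed(5) by blast+

lemma Q_sum_left:
  "(\<And>x. x \<in> S \<Longrightarrow> f x \<in> W k) \<Longrightarrow> v \<in> W k \<Longrightarrow> Q k (sum f S) v = (\<Sum>x\<in>S. Q k (f x) v)"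
proof (induction S rule: infinite_finite_induct)
  case (insert x S)
  then show ?case
    using vec.subspace_sum[OF subspace_W, of S f k] by (simp add: Q_add_left)
qed (auto simp: Q_zero)

lemma Q_sum_right:
  "(\<And>x. x \<in> S \<Longrightarrow> f x \<in> W k) \<Longrightarrow> v \<in> W k \<Longrightarrow> Q k v (sum f S) = (\<Sum>x\<in>S. Q k v (f x))"
proof (induction S rule: infinite_finite_induct)
  case (insert x S)
  then show ?case
    using vec.subspace_sum[OF subspace_W, of S f k] by (simp add: Q_add_right)
qed (auto simp: Q_zero)

text \<open>Rationality gives the identity on rational vectors; it extends to their span in one
  argument at a time, since both sides are antilinear.\<close>

lemma Q_real:
  assumes "u \<in> W k" "v \<in> W k"
  shows "cnj (Q k u v) = Q k (vcnj u) (vcnj v)"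
proof -
  have cnj_rat: "cnj x = x" if "x \<in> \<rat>" for x :: complex
    using that by (cases rule: Rats_cases') simp
  let ?R = "W k \<inter> {v. rat_vec v}"
  have 1: "W k \<subseteq> {u \<in> W k. cnj (Q k u v) = Q k (vcnj u) v}" if v: "v \<in> ?R" for v
  proof -
    have "vec.span ?R \<subseteq> {u \<in> W k. cnj (Q k u v) = Q k (vcnj u) v}"
      using v by (intro vec.span_minimal)
        (auto simp: vec.subspace_def W_closed Q_zero Q_add_left Q_scale_left vcnj_W vcnj_rat_vec Q_rat cnj_rat)
    then show ?thesis
      using W_rational[of k] by blast
  qed
  have 2: "cnj (Q k u v) = Q k (vcnj u) v" if "v \<in> W k" "rat_vec v" for v
    using 1[of v] assms(1) that by blast
  have "vec.span ?R \<subseteq> {v \<in> W k. cnj (Q k u v) = Q k (vcnj u) (vcnj v)}"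
    using assms(1) vcnj_W[OF assms(1)] by (intro vec.span_minimal)
      (auto simp: vec.subspace_def W_closed Q_zero Q_add_right Q_scale_right vcnj_W vcnj_rat_vec 2)
  then show ?thesis
    using W_rational[of k] assms by blast
qed

text \<open>The bidegree-reversing part of conjugation: from the conjugate of each component the
  lower error terms are discarded.\<close>

definition bconj :: "complex^'n \<Rightarrow> complex^'n" where
  "bconj v = (\<Sum>(p, q)\<in>bsupp I. cmp q p (vcnj (cmp p q v)))"

lemma cmp_bconj: "cmp r s (bconj v) = cmp r s (vcnj (cmp s r v))"
proof -
  have "cmp r s (bconj v) = (\<Sum>x\<in>bsupp I. if x = (s, r) then cmp r s (vcnj (cmp s r v)) else 0)"
    unfolding bconj_def bcomp_simps by (intro sum.cong) (auto simp: bcomp_piece[OF bcomp_in] split: if_splits)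
  also have "\<dots> = cmp r s (vcnj (cmp s r v))"
    using finite_bsupp by (auto simp: bcomp_outside bcomp_simps)
  finally show ?thesis .
qed

lemma bconj_add: "bconj (u + v) = bconj u + bconj v"
  by (rule eq_if_bcomp) (simp add: cmp_bconj bcomp_add)

lemma bconj_scale: "bconj (c *s v) = cnj c *s bconj v"
  by (rule eq_if_bcomp) (simp add: cmp_bconj bcomp_scale)

lemma bconj_piece: "v \<in> I p q \<Longrightarrow> bconj v = cmp q p (vcnj v)"
  by (rule eq_if_bcomp) (auto simp: cmp_bconj bcomp_piece[OF bcomp_in] bcomp_piece bcomp_simps)

lemma bconj_I: "v \<in> I p q \<Longrightarrow> bconj v \<in> I q p"
  by (simp add: bconj_piece)

text \<open>The discarded terms have r \<le> q - 1 and s \<le> p - 1, so they lie at least two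
  weights lower.\<close>

lemma vcnj_bconj:
  assumes v: "v \<in> W k"
  shows "vcnj v - bconj v \<in> W (k - 2)"
  unfolding W_iff
proof (intro allI impI)
  fix a b assume ab: "k - 2 < a + b"
  have "cmp a b (vcnj v) = cmp a b (vcnj (\<Sum>(p, q)\<in>bsupp I. cmp p q v))"
    by (simp only: bcomp_sum)
  also have "\<dots> = (\<Sum>(p, q)\<in>bsupp I. cmp a b (vcnj (cmp p q v)))"
    by (simp add: bcomp_simps case_prod_unfold)
  also have "\<dots> = (\<Sum>x\<in>bsupp I. if x = (b, a) then cmp a b (vcnj (cmp b a v)) else 0)"
  proof (intro sum.cong refl, clarify)
    fix p q
    have "cmp a b (vcnj (cmp p q v)) = 0" if ne: "(p, q) \<noteq> (b, a)"
    proof (cases "p + q \<le> k")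
      case True
      then show ?thesis
        using ne ab by (intro cmp_vcnj[OF bcomp_in]) auto
    next
      case False
      then show ?thesis
        using v by (simp add: W_iff bcomp_simps)
    qed
    then show "cmp a b (vcnj (cmp p q v)) = (if (p, q) = (b, a) then cmp a b (vcnj (cmp b a v)) else 0)"
      by auto
  qed
  also have "\<dots> = cmp a b (bconj v)"
    using finite_bsupp by (auto simp: bcomp_outside bcomp_simps cmp_bconj)
  finally show "cmp a b (vcnj v - bconj v) = 0"
    by (simp add: bcomp_simps)
qed

lemma bconj_W: "v \<in> W k \<Longrightarrow> bconj v \<in> W k"
  using W_closed(2)[of "vcnj v" k "vcnj v - bconj v"] vcnj_W vcnj_bconj W_monoD[of "vcnj v - bconj v" "k - 2" k]
  by simp

text \<open>For x in a piece of weight k, \<open>bconj x\<close> agrees with \<open>vcnj x\<close>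
  modulo W_{k-2}. Conjugating back returns x up to W_{k-2}, which has no component in weight
  k.\<close>

lemma bconj_bconj: "bconj (bconj v) = v"
proof (rule eq_if_bcomp)
  fix r s
  let ?x = "cmp r s v"
  have "vcnj (vcnj ?x - bconj ?x) \<in> W (r + s - 2)"
    by (intro vcnj_W vcnj_bconj) simp
  then have "cmp r s (vcnj (vcnj ?x - bconj ?x)) = 0"
    by (simp add: W_iff)
  then have "cmp r s (vcnj (bconj ?x)) = ?x"
    by (simp add: bcomp_simps bcomp_piece[OF bcomp_in])
  then show "cmp r s (bconj (bconj v)) = ?x"
    by (simp add: cmp_bconj bconj_piece[OF bcomp_in])
qed

lemma vcnj_bconj_cong:
  assumes "v \<in> W k" shows "bconj v - vcnj v \<in> W (k - 1)" "vcnj (bconj v) - v \<in> W (k - 1)"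
proof -
  have "vcnj v - bconj v \<in> W (k - 1)"
    using vcnj_bconj[OF assms] W_monoD by simp
  then show "bconj v - vcnj v \<in> W (k - 1)"
    using W_closed(4) by fastforce
  from vcnj_W[OF this] show "vcnj (bconj v) - v \<in> W (k - 1)"
    by simp
qed

lemma swap_bsupp: "(q, p) \<in> bsupp I \<longleftrightarrow> (p, q) \<in> bsupp I"
proof -
  have "I q p \<noteq> {0}" if "I p q \<noteq> {0}" for p q
  proof
    assume 0: "I q p = {0}"
    have "v = 0" if "v \<in> I p q" for v
      using bconj_I[OF that] bconj_bconj[of v] bconj_scale[of 0 0] 0 by simp
    then show False
      using that zero_piece by blast
  qed
  then show ?thesis
    by (auto simp: bsupp_def)
qed

section \<open>The metric in explicit form: uniqueness, positivity, symmetry\<close>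

definition hform :: "complex^'n \<Rightarrow> complex^'n \<Rightarrow> complex" where
  "hform u v = (\<Sum>(p, q)\<in>bsupp I. \<i> powi (p - q) * Q (p + q) (cmp p q u) (vcnj (cmp p q v)))"

lemma hform_piece_left:
  assumes "u \<in> I p q"
  shows "hform u v = \<i> powi (p - q) * Q (p + q) u (vcnj (cmp p q v))"
proof -
  have "hform u v = (\<Sum>x\<in>bsupp I. if x = (p, q) then \<i> powi (p - q) * Q (p + q) u (vcnj (cmp p q v)) else 0)"
    unfolding hform_def by (intro sum.cong) (auto simp: bcomp_piece[OF assms] Q_zero split: if_splits)
  then show ?thesis
    using finite_bsupp not_bsupp[OF _ assms] by (auto simp: Q_zero)
qed

lemma hform_piece:
  "u \<in> I p q \<Longrightarrow> v \<in> I p q \<Longrightarrow> hform u v = \<i> powi (p - q) * Q (p + q) u (vcnj v)"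
  by (simp add: hform_piece_left bcomp_piece)

lemma hform_orthogonal:
  "u \<in> I p q \<Longrightarrow> v \<in> I p' q' \<Longrightarrow> (p, q) \<noteq> (p', q') \<Longrightarrow> hform u v = 0"
  using I_W[of u p q] by (auto simp: hform_piece_left bcomp_piece Q_zero)

lemma sesquilinear_hform: "sesquilinear hform"
  unfolding sesquilinear_def hform_def
  by (simp add: bcomp_add bcomp_scale Q_add_left Q_add_right Q_scale_left Q_scale_right
      sum.distrib[symmetric] sum_distrib_left case_prod_unfold algebra_simps)

text \<open>A sesquilinear form is determined by its values on pairs of pieces. This evaluates the
  definite description of the metric and later identifies its pull-back under g.\<close>

lemma hform_unique:
  assumes h: "sesquilinear h"
    and orth: "\<And>p q p' q' u v. (p, q) \<noteq> (p', q') \<Longrightarrow> u \<in> I p q \<Longrightarrow> v \<in> I p' q' \<Longrightarrow> h u v = 0"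
    and diag: "\<And>p q u v. u \<in> I p q \<Longrightarrow> v \<in> I p q \<Longrightarrow> h u v = \<i> powi (p - q) * Q (p + q) u (vcnj v)"
  shows "h = hform"
proof (intro ext)
  fix u v
  have comp: "h (cmp p q u) (cmp p' q' v) = hform (cmp p q u) (cmp p' q' v)" for p q p' q'
    by (cases "(p, q) = (p', q')")
      (auto simp: diag[OF bcomp_in bcomp_in] hform_piece[OF bcomp_in bcomp_in] orth[OF _ bcomp_in bcomp_in] hform_orthogonal[OF bcomp_in bcomp_in])
  have ex: "k u v = (\<Sum>(p, q)\<in>bsupp I. \<Sum>(p', q')\<in>bsupp I. k (cmp p q u) (cmp p' q' v))" if "sesquilinear k" for k
  proof -
    have "k u v = k (\<Sum>(p, q)\<in>bsupp I. cmp p q u) (\<Sum>(p, q)\<in>bsupp I. cmp p q v)"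
      by (simp only: bcomp_sum)
    also have "\<dots> = (\<Sum>x\<in>bsupp I. k (cmp (fst x) (snd x) u) (\<Sum>(p, q)\<in>bsupp I. cmp p q v))"
      by (simp only: sesquilinear_sum(1)[OF that] case_prod_unfold)
    finally show ?thesis
      by (simp only: sesquilinear_sum(2)[OF that] case_prod_unfold)
  qed
  show "h u v = hform u v"
    unfolding ex[OF h] ex[OF sesquilinear_hform] by (simp add: comp)
qed

lemma mh_metric_eq: "mh_metric W Q F = hform"
  unfolding mh_metric_def
proof (rule the_equality)
  fix h
  assume "sesquilinear h \<and>
     (\<forall>p q p' q'. (p, q) \<noteq> (p', q') \<longrightarrow> (\<forall>u\<in>I p q. \<forall>v\<in>I p' q'. h u v = 0)) \<and>
     (\<forall>p q. \<forall>u\<in>I p q. \<forall>v\<in>I p q. h u v = \<i> powi (p - q) * Q (p + q) u (vcnj v))"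
  then show "h = hform"
    by (intro hform_unique) blast+
qed (use sesquilinear_hform hform_piece hform_orthogonal in blast)

text \<open>The polarization gives positivity on lifts of H^{p,q}. The conjugate of x is congruent
  to \<open>bconj x\<close>, which lies in I^{q,p}, so x belongs to such a lift; its class in Gr is
  nonzero because x has no component of lower weight.\<close>

lemma hform_piece_pos:
  assumes x: "x \<in> I p q" "x \<noteq> 0"
  shows "Im (hform x x) = 0" "Re (hform x x) > 0"
proof -
  let ?k = "p + q"
  have xk: "x \<in> W ?k" "x \<in> F p"
    using x I_W I_F by auto
  have "x \<in> Fgr W F ?k p"
    unfolding Fgr_def sumsp_def using xk W_closed(5) by force
  moreover have "vcnj x \<in> Fgr W F ?k (?k - p)"
  proof -
    have "bconj x \<in> F q"
      using bconj_I[OF x(1)] I_F by blast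
    moreover have "vcnj x - bconj x \<in> W (?k - 1)"
      using vcnj_bconj[OF xk(1)] W_monoD by simp
    moreover have "vcnj x = bconj x + (vcnj x - bconj x)"
      by simp
    ultimately show ?thesis
      unfolding Fgr_def sumsp_def using bconj_W[OF xk(1)] by (simp, blast)
  qed
  ultimately have "x \<in> hodge_lift W F ?k p"
    by (simp add: hodge_lift_def mem_cnjset)
  moreover have "x \<notin> W (?k - 1)"
    using x by (auto simp: W_iff bcomp_piece)
  ultimately have "Im (\<i> powi (p - (?k - p)) * Q ?k x (vcnj x)) = 0 \<and>
        Re (\<i> powi (p - (?k - p)) * Q ?k x (vcnj x)) > 0"
    using pol unfolding graded_polarized_def by blast
  then show "Im (hform x x) = 0" "Re (hform x x) > 0"
    using x by (simp_all add: hform_piece)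
qed

lemma hform_eq_sum: "hform u v = (\<Sum>(p, q)\<in>bsupp I. hform (cmp p q u) (cmp p q v))"
  by (simp add: hform_def[of u v] hform_piece[OF bcomp_in bcomp_in])

lemma hform_self: "Im (hform v v) = 0" "v \<noteq> 0 \<Longrightarrow> Re (hform v v) > 0"
proof -
  have c: "Im (hform (cmp p q v) (cmp p q v)) = 0" "Re (hform (cmp p q v) (cmp p q v)) \<ge> 0" for p q
  proof -
    have "Im (hform (cmp p q v) (cmp p q v)) = 0 \<and> Re (hform (cmp p q v) (cmp p q v)) \<ge> 0"
    proof (cases "cmp p q v = 0")
      case True
      then show ?thesis
        by (simp add: hform_def bcomp_simps Q_zero W_closed)
    next
      case False
      then show ?thesis
        using hform_piece_pos[OF bcomp_in] by (simp add: less_imp_le)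
    qed
    then show "Im (hform (cmp p q v) (cmp p q v)) = 0" "Re (hform (cmp p q v) (cmp p q v)) \<ge> 0"
      by auto
  qed
  show "Im (hform v v) = 0"
    by (subst hform_eq_sum) (simp add: Im_sum case_prod_unfold c)
  show "Re (hform v v) > 0" if nz: "v \<noteq> 0"
  proof -
    obtain p q where pq: "cmp p q v \<noteq> 0"
      using nz eq_zero_if_bcomp[of v] by blast
    then have "(p, q) \<in> bsupp I"
      using bcomp_outside[of p q v] by blast
    then have "0 < (\<Sum>x\<in>bsupp I. Re (hform (cmp (fst x) (snd x) v) (cmp (fst x) (snd x) v)))"
      using finite_bsupp hform_piece_pos(2)[OF bcomp_in pq]
      by (intro sum_pos2[of _ "(p, q)"]) (auto simp: c)
    then show ?thesis
      by (subst hform_eq_sum) (simp add: Re_sum case_prod_unfold)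
  qed
qed

lemma hform_hermitian: "hform u v = cnj (hform v u)"
  using sesquilinear_hermitian[OF sesquilinear_hform] hform_self(1) by blast

lemma cmp_bconj_swap: "cmp p q (bconj v) = bconj (cmp q p v)"
  by (simp add: cmp_bconj bconj_piece[OF bcomp_in])

text \<open>On each component the two conjugations cancel modulo lower weight, which leaves
  \<open>Q\<close> with its arguments exchanged. Parity and \<open>i_powi_swap\<close> restore the
  factor for (q, p), and the sum is reindexed by the swap.\<close>

lemma hform_bconj: "hform (bconj u) (bconj v) = hform v u"
proof -
  have tm: "\<i> powi (p - q) * Q (p + q) (cmp p q (bconj u)) (vcnj (cmp p q (bconj v)))
      = \<i> powi (q - p) * Q (q + p) (cmp q p v) (vcnj (cmp q p u))" for p q
  proof -
    let ?x = "cmp q p u" and ?y = "cmp q p v"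
    have W: "?x \<in> W (p + q)" "?y \<in> W (p + q)" "vcnj ?x \<in> W (p + q)"
      using cmp_W[of q p] by (simp_all add: add.commute)
    have "Q (p + q) (cmp p q (bconj u)) (vcnj (cmp p q (bconj v))) = Q (p + q) (vcnj ?x) ?y"
      unfolding cmp_bconj_swap by (intro Q_cong W vcnj_bconj_cong)
    also have "\<dots> = (-1) powi (p + q) * Q (p + q) ?y (vcnj ?x)"
      by (intro Q_parity W)
    finally show ?thesis
      using i_powi_swap[of p q] by (simp add: add.commute mult.assoc[symmetric])
  qed
  show ?thesis
    unfolding hform_def[of "bconj u"] hform_def[of v] tm
    by (rule sum.reindex_bij_witness[of _ prod.swap prod.swap]) (auto simp: swap_bsupp)
qed

definition weight_supp :: "int \<Rightarrow> (int \<times> int) set" where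
  "weight_supp k = {(p, q) \<in> bsupp I. p + q = k}"

lemma finite_weight_supp: "finite (weight_supp k)"
  unfolding weight_supp_def using finite_bsupp by (auto intro: finite_subset)

lemma weight_supp_cong:
  assumes "v \<in> W k"
  shows "v - (\<Sum>(p, q)\<in>weight_supp k. cmp p q v) \<in> W (k - 1)"
  unfolding W_iff
proof (intro allI impI)
  fix a b :: int assume ab: "k - 1 < a + b"
  have "cmp a b (\<Sum>(p, q)\<in>weight_supp k. cmp p q v) = (if (a, b) \<in> weight_supp k then cmp a b v else 0)"
    by (rule bcomp_unique[OF _ finite_weight_supp]) auto
  moreover have "cmp a b v = 0" if "(a, b) \<notin> weight_supp k"
  proof (cases "a + b = k")
    case True
    then show ?thesis
      using that bcomp_outside[of a b v] by (auto simp: weight_supp_def)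
  next
    case False
    then show ?thesis
      using assms ab by (auto simp: W_iff)
  qed
  ultimately show "cmp a b (v - (\<Sum>(p, q)\<in>weight_supp k. cmp p q v)) = 0"
    by (simp add: bcomp_simps(2))
qed

text \<open>If p' > q, this is the first bilinear relation, as p + p' exceeds k. If p' < q,
  conjugation exchanges the two indices of each vector and leads back to that case, since Q_k does
  not distinguish \<open>vcnj\<close> from \<open>bconj\<close>.\<close>

lemma Q_orthogonal:
  assumes x: "x \<in> I p q" and y: "y \<in> I p' q'" and k: "p + q = k" "p' + q' = k" and ne: "p' \<noteq> q"
  shows "Q k x y = 0"
proof -
  have van: "Q k u v = 0" if "u \<in> I a b" "v \<in> I a' b'" "a + b = k" "a' + b' = k" "b < a'" for u v a b a' b'
  proof -
    have "u \<in> F a \<inter> W k" "v \<in> F (k - a + 1) \<inter> W k"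
      using that(3-5) I_F[OF that(1)] I_W[OF that(1)] I_W[OF that(2)]
        F_monoD[OF I_F[OF that(2)], of "k - a + 1"] by auto
    then show ?thesis
      using pol unfolding graded_polarized_def by blast
  qed
  show ?thesis
  proof (cases "q < p'")
    case True
    then show ?thesis
      using van x y k by blast
  next
    case False
    have W: "x \<in> W k" "y \<in> W k"
      using I_W[OF x] I_W[OF y] k by auto
    have "cnj (Q k x y) = Q k (vcnj x) (vcnj y)"
      by (rule Q_real[OF W])
    also have "\<dots> = Q k (bconj x) (bconj y)"
      by (rule Q_cong[symmetric]) (use W vcnj_W vcnj_bconj_cong in auto)
    also have "\<dots> = 0"
      by (rule van[OF bconj_I[OF x] bconj_I[OF y]]) (use k ne False in auto)
    finally show ?thesis
      by simp
  qed
qed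

text \<open>The formula of the metric solved for \<open>Q\<close>: the component of v that pairs
  with I^{p,q} is the one of type (q, p), congruent to the conjugate of the (p, q) component of
  \<open>bconj v\<close>, and i^{q-p} inverts the factor of the metric.\<close>

lemma Q_eq_hform:
  assumes u: "u \<in> W k" and v: "v \<in> W k"
  shows "Q k u v = (\<Sum>(p, q)\<in>weight_supp k. \<i> powi (q - p) * hform (cmp p q u) (bconj v))"
proof -
  have cW: "cmp p q w \<in> W k" if "(p, q) \<in> weight_supp k" for p q w
    using that cmp_W(1)[of p q w] by (auto simp: weight_supp_def)
  have sW: "(\<Sum>(p, q)\<in>weight_supp k. cmp p q w) \<in> W k" for w
    by (rule vec.subspace_sum[OF subspace_W]) (auto intro: cW)
  have right: "Q k (cmp p q u) v = \<i> powi (q - p) * hform (cmp p q u) (bconj v)" if pq: "(p, q) \<in> weight_supp k" for p q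
  proof -
    let ?x = "cmp p q u"
    have k: "p + q = k" and qp: "(q, p) \<in> weight_supp k"
      using pq swap_bsupp by (auto simp: weight_supp_def)
    have "Q k ?x v = Q k ?x (\<Sum>(p, q)\<in>weight_supp k. cmp p q v)"
      by (rule Q_cong) (use cW pq sW weight_supp_cong v W_closed in auto)
    also have "\<dots> = (\<Sum>(a, b)\<in>weight_supp k. Q k ?x (cmp a b v))"
      by (subst Q_sum_right) (use cW pq in \<open>auto simp: case_prod_unfold\<close>)
    also have "\<dots> = (\<Sum>y\<in>weight_supp k. if y = (q, p) then Q k ?x (cmp q p v) else 0)"
    proof (intro sum.cong refl, clarify)
      fix a b assume ab: "(a, b) \<in> weight_supp k"
      have "Q k ?x (cmp a b v) = 0" if "(a, b) \<noteq> (q, p)"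
        using Q_orthogonal[OF bcomp_in bcomp_in, of p q k a b u v] k ab that by (auto simp: weight_supp_def)
      then show "Q k ?x (cmp a b v) = (if (a, b) = (q, p) then Q k ?x (cmp q p v) else 0)"
        by auto
    qed
    also have "\<dots> = Q k ?x (cmp q p v)"
      using finite_weight_supp qp by simp
    also have "\<dots> = Q k ?x (vcnj (cmp p q (bconj v)))"
      unfolding cmp_bconj_swap by (rule Q_cong[symmetric]) (use cW pq qp vcnj_bconj_cong W_closed in auto)
    also have "\<dots> = \<i> powi (q - p) * hform ?x (bconj v)"
      unfolding hform_piece_left[OF bcomp_in] k mult.assoc[symmetric]
      by (simp add: power_int_add[symmetric])
    finally show ?thesis .
  qed
  have "Q k u v = Q k (\<Sum>(p, q)\<in>weight_supp k. cmp p q u) v"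
    by (rule Q_cong) (use u v sW weight_supp_cong W_closed in auto)
  also have "\<dots> = (\<Sum>(p, q)\<in>weight_supp k. Q k (cmp p q u) v)"
    by (subst Q_sum_left) (use cW v in \<open>auto simp: case_prod_unfold\<close>)
  also have "\<dots> = (\<Sum>(p, q)\<in>weight_supp k. \<i> powi (q - p) * hform (cmp p q u) (bconj v))"
    by (intro sum.cong) (auto simp: right)
  finally show ?thesis .
qed

end

section \<open>Transitivity\<close>

context polarized_mhs
begin

lemma inner_form_hform: "inner_form hform"
  unfolding inner_form_def using sesquilinear_hform hform_hermitian hform_self(2) by blast

text \<open>\<open>bconj\<close> identifies the two pieces but is antilinear. It is factored as
  \<open>vcnj\<close>, known to preserve dimensions, followed by the linear projection to I^{q,p},
  which is injective on the conjugate of I^{p,q}.\<close>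

lemma dim_I_swap: "vec.dim (I q p) = vec.dim (I p q)"
proof -
  have le: "vec.dim (I p q) \<le> vec.dim (I q p)" for p q
  proof -
    have sub: "vec.subspace (vcnj ` I p q)"
    proof -
      have "vcnj ` I p q = {v. vcnj v \<in> I p q}"
        using mem_cnjset[of _ "I p q"] unfolding cnjset_def by blast
      then show ?thesis
        using subspace_vimage_vcnj[OF subspace_piece] by simp
    qed
    have "inj_on (cmp q p) (vcnj ` I p q)"
    proof (rule inj_onI)
      fix x y assume "x \<in> vcnj ` I p q" "y \<in> vcnj ` I p q" and eq: "cmp q p x = cmp q p y"
      then obtain u v where uv: "x = vcnj u" "y = vcnj v" "u \<in> I p q" "v \<in> I p q"
        by blast
      then have "bconj u = bconj v"
        using eq by (simp add: bconj_piece)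
      then show "x = y"
        using bconj_bconj uv by metis
    qed
    then have "inj_on (cmp q p) (vec.span (vcnj ` I p q))"
      using sub by (simp add: vec.span_eq_iff[THEN iffD2])
    then have "vec.dim (cmp q p ` vcnj ` I p q) = vec.dim (vcnj ` I p q)"
      by (rule vec.dim_image_eq[OF linear_bcomp])
    also have "\<dots> = vec.dim (I p q)"
      by (rule dim_vcnj_image)
    finally show ?thesis
      using vec.dim_subset[of "cmp q p ` vcnj ` I p q" "I q p"] by (simp add: image_subset_iff)
  qed
  show ?thesis
    using le[of p q] le[of q p] by simp
qed

end

lemma hodge_isometry_exists:
  assumes P: "polarized_mhs W F Q" and P': "polarized_mhs W F' Q"
    and dim: "\<And>p q. vec.dim (deligne W F p q) = vec.dim (deligne W F' p q)"
  shows "\<exists>g\<in>Hgrp W Q. act g F = F'"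
proof -
  interpret P: polarized_mhs W F Q
    by (rule P)
  interpret P': polarized_mhs W F' Q
    by (rule P')
  let ?lin = "Vector_Spaces.linear ((*s) :: complex \<Rightarrow> complex^'a \<Rightarrow> complex^'a) ((*s) :: complex \<Rightarrow> complex^'a \<Rightarrow> complex^'a)"
  have "\<exists>f. ?lin f \<and> (\<forall>u\<in>P.I p q. f u \<in> P'.I p q) \<and> (\<forall>u\<in>P.I p q. \<forall>v\<in>P.I p q. P'.hform (f u) (f v) = P.hform u v)
      \<and> (p = q \<longrightarrow> (\<forall>u\<in>P.I p q. f (P.bconj u) = P'.bconj (f u)))" for p q
  proof (cases "p = q")
    case True
    have "\<exists>f. ?lin f \<and> (\<forall>u\<in>P.I q q. f u \<in> P'.I q q) \<and> (\<forall>u\<in>P.I q q. \<forall>v\<in>P.I q q. P'.hform (f u) (f v) = P.hform u v)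
      \<and> (\<forall>u\<in>P.I q q. f (P.bconj u) = P'.bconj (f u))"
      by (rule subspace_real_isometry_exists[OF P.inner_form_hform P'.inner_form_hform P.subspace_piece P'.subspace_piece
            dim P.bconj_add P.bconj_scale P.bconj_bconj P.bconj_I P.hform_bconj P'.bconj_add P'.bconj_scale P'.bconj_bconj P'.bconj_I P'.hform_bconj])
    then show ?thesis
      using True by simp
  next
    case False
    have "\<exists>f. ?lin f \<and> (\<forall>u\<in>P.I p q. f u \<in> P'.I p q) \<and> (\<forall>u\<in>P.I p q. \<forall>v\<in>P.I p q. P'.hform (f u) (f v) = P.hform u v)"
      by (rule subspace_isometry_exists[OF P.inner_form_hform P'.inner_form_hform P.subspace_piece P'.subspace_piece dim])
    then show ?thesis
      using False by blast
  qed
  then obtain G0 where G0: "\<And>p q. ?lin (G0 p q)" "\<And>p q u. u \<in> P.I p q \<Longrightarrow> G0 p q u \<in> P'.I p q"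
    "\<And>p q u v. u \<in> P.I p q \<Longrightarrow> v \<in> P.I p q \<Longrightarrow> P'.hform (G0 p q u) (G0 p q v) = P.hform u v"
    "\<And>p u. u \<in> P.I p p \<Longrightarrow> G0 p p (P.bconj u) = P'.bconj (G0 p p u)"
    by metis
  \<comment> \<open>For p > q the map is transported by the two involutions, the only option
    compatible with them. On the diagonal compatibility was built into \<open>G0\<close>.\<close>
  define G where "G p q = (if p \<le> q then G0 p q else (\<lambda>u. P'.bconj (G0 q p (P.bconj u))))" for p q
  have G_add: "G p q (u + v) = G p q u + G p q v" for p q u v
    by (simp add: G_def vec.linear_add[OF G0(1)] P.bconj_add P'.bconj_add)
  have G_scale: "G p q (c *s u) = c *s G p q u" for p q c u
    by (simp add: G_def vec.linear_scale[OF G0(1)] P.bconj_scale P'.bconj_scale)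
  have G_zero: "G p q 0 = 0" for p q
    using G_scale[of p q 0 0] by simp
  have G_in: "G p q u \<in> P'.I p q" if "u \<in> P.I p q" for p q u
    using that by (auto simp: G_def intro: G0 P.bconj_I P'.bconj_I)
  have G_iso: "P'.hform (G p q u) (G p q v) = P.hform u v" if "u \<in> P.I p q" "v \<in> P.I p q" for p q u v
    using that by (auto simp: G_def G0(3) P.bconj_I P.hform_bconj P'.hform_bconj)
  have G_bconj: "G q p (P.bconj u) = P'.bconj (G p q u)" if "u \<in> P.I p q" for p q u
    using that by (cases "p = q") (auto simp: G_def G0(4) P.bconj_bconj P'.bconj_bconj)
  have supp: "bsupp P'.I = bsupp P.I"
  proof -
    have "P'.I p q = {0} \<longleftrightarrow> P.I p q = {0}" for p q
      using dim[of p q] vec.dim_eq_0[of "P.I p q"] vec.dim_eq_0[of "P'.I p q"] P.zero_piece[of p q] P'.zero_piece[of p q]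
      by (metis insert_not_empty subset_singletonD subset_refl empty_iff)
    then show ?thesis
      by (auto simp: bsupp_def)
  qed
  define f where "f v = (\<Sum>(p, q)\<in>bsupp P.I. G p q (P.cmp p q v))" for v
  have lin: "?lin f"
    by unfold_locales (simp_all add: f_def P.bcomp_add P.bcomp_scale G_add G_scale sum.distrib vec.scale_sum_right case_prod_unfold)
  have cmp_f: "P'.cmp p q (f v) = G p q (P.cmp p q v)" for p q v
    by (subst P'.bcomp_unique[of "bsupp P.I" "\<lambda>p q. G p q (P.cmp p q v)"])
      (auto simp: f_def P.finite_bsupp G_in P.bcomp_outside G_zero)
  have f_iso: "P'.hform (f u) (f v) = P.hform u v" for u v
    unfolding P'.hform_eq_sum[of "f u"] P.hform_eq_sum[of u] supp
    by (intro sum.cong) (auto simp: cmp_f G_iso)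
  have f_bconj: "f (P.bconj v) = P'.bconj (f v)" for v
    by (rule P'.eq_if_bcomp) (simp add: cmp_f P.cmp_bconj_swap P'.cmp_bconj_swap G_bconj)
  have G_zero_iff: "G p q u = 0 \<longleftrightarrow> u = 0" if "u \<in> P.I p q" for p q u
    using G_iso[OF that that] P.hform_self(2)[of u] G_zero[of p q] inner_form_simps(5)[OF P'.inner_form_hform, of "G p q u"]
    by (cases "u = 0") auto
  have f_inj: "v = 0" if "f v = 0" for v
  proof (rule P.eq_zero_if_bcomp)
    fix p q
    have "G p q (P.cmp p q v) = 0"
      using cmp_f[of p q v] that by (simp add: P'.bcomp_simps)
    then show "P.cmp p q v = 0"
      using G_zero_iff[OF P.bcomp_in] by blast
  qed
  define g where "g = matrix f"
  have gv: "g *v v = f v" for v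
    unfolding g_def by (rule matrix_works[OF lin])
  have inv: "invertible g"
    unfolding invertible_left_inverse matrix_left_invertible_ker by (auto simp: gv f_inj)
  have surj: "\<exists>u. v = f u" for v
    using inv unfolding invertible_def by (metis gv matrix_vector_mul_assoc matrix_vector_mul_lid)
  have image: "(\<lambda>v. g *v v) ` A = A'" if "\<And>v. f v \<in> A' \<longleftrightarrow> v \<in> A" for A A'
    using that surj by (force simp: gv)
  have F: "f v \<in> F' p \<longleftrightarrow> v \<in> F p" for p v
    by (simp add: P.F_iff P'.F_iff cmp_f G_zero_iff)
  have Wf: "f v \<in> W p \<longleftrightarrow> v \<in> W p" for p v
    using P.W_iff[of v p] P'.W_iff[of "f v" p] by (simp add: cmp_f G_zero_iff)
  \<comment> \<open>Modulo W_{k-2}, \<open>vcnj (f v)\<close> agrees with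
    \<open>P'.bconj (f v)\<close>, which equals \<open>f (P.bconj v)\<close>, which agrees with
    \<open>f (vcnj v)\<close> because f preserves W_{k-2}.\<close>
  have real2: "vcnj (f v) - f (vcnj v) \<in> W (k - 2)" if v: "v \<in> W k" for v k
  proof -
    have 1: "vcnj (f v) - f (P.bconj v) \<in> W (k - 2)"
      unfolding f_bconj using P'.vcnj_bconj[of "f v" k] Wf v by blast
    have 2: "f (vcnj v - P.bconj v) \<in> W (k - 2)"
      using P.vcnj_bconj[OF v] Wf by blast
    have "vcnj (f v) - f (P.bconj v) - f (vcnj v - P.bconj v) \<in> W (k - 2)"
      by (intro P.W_closed 1 2)
    then show ?thesis
      by (simp add: vec.linear_diff[OF lin])
  qed
  have weight_supp: "P'.weight_supp k = P.weight_supp k" for k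
    by (simp add: P.weight_supp_def P'.weight_supp_def supp)
  have f_cmp: "f (P.cmp p q v) = P'.cmp p q (f v)" for p q v
    by (rule P'.eq_if_bcomp) (auto simp: cmp_f P.bcomp_piece[OF P.bcomp_in] P'.bcomp_piece[OF G_in[OF P.bcomp_in]] G_zero)
  have Qf: "Q k (f u) (f v) = Q k u v" if "u \<in> W k" "v \<in> W k" for k u v
    using that Wf P.Q_eq_hform[OF that] P'.Q_eq_hform[of "f u" k "f v"]
    by (simp add: weight_supp f_cmp[symmetric] f_bconj[symmetric] f_iso)
  have "g \<in> Hgrp W Q"
    unfolding Hgrp_def Ggrp_def gr_real_def mem_Collect_eq gv
  proof (intro conjI allI ballI)
    show "f ` W k = W k" for k
      using image[OF Wf] by (simp add: gv)
    show "vcnj (f v) - f (vcnj v) \<in> W (k - 1)" if "v \<in> W k" for v k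
      using real2[OF that] P.W_monoD by simp
  qed (use inv real2 Qf in auto)
  moreover have "act g F = F'"
    unfolding act_def using image[OF F] by blast
  ultimately show ?thesis
    by blast
qed

section \<open>Hodge numbers from the dimensions of F^p and W_k\<close>

lemma (in bigrading) dim_span_pieces_step:
  assumes T: "finite T" "\<And>a b. (a, b) \<in> T \<Longrightarrow> P a b \<and> \<not> P' a b"
    and cover: "\<And>a b. I a b \<noteq> {0} \<Longrightarrow> P a b \<Longrightarrow> \<not> P' a b \<Longrightarrow> (a, b) \<in> T"
    and mono: "\<And>a b. P' a b \<Longrightarrow> P a b"
  shows "vec.dim (vec.span (\<Union>{I a b |a b. P a b})) =
    vec.dim (vec.span (\<Union>{I a b |a b. P' a b})) + (\<Sum>(a, b)\<in>T. vec.dim (I a b))"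
proof -
  let ?d = "\<lambda>(a, b). vec.dim (I a b)"
  let ?S = "\<lambda>P. {x \<in> bsupp I. case_prod P x}"
  have fin: "finite (?S P)" for P
    using finite_bsupp by simp
  have "?S P = ?S P' \<union> (T \<inter> bsupp I)"
  proof (rule set_eqI)
    fix x :: "int \<times> int"
    obtain a b where x: "x = (a, b)"
      by force
    show "x \<in> ?S P \<longleftrightarrow> x \<in> ?S P' \<union> (T \<inter> bsupp I)"
      unfolding x using T(2)[of a b] cover[of a b] mono[of a b] by (simp add: bsupp_def) blast
  qed
  then have "sum ?d (?S P) = sum ?d (?S P' \<union> (T \<inter> bsupp I))"
    by (rule arg_cong)
  also have "\<dots> = sum ?d (?S P') + sum ?d (T \<inter> bsupp I)"
    using T fin by (intro sum.union_disjoint) auto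
  \<comment> \<open>\<open>T\<close> may list pieces that are zero; these add nothing to the
    dimension.\<close>
  also have "sum ?d (T \<inter> bsupp I) = sum ?d T"
  proof (rule sum.mono_neutral_left)
    show "\<forall>x\<in>T - T \<inter> bsupp I. ?d x = 0"
      by (simp add: bsupp_def case_prod_unfold)
  qed (use T(1) in auto)
  finally show ?thesis
    unfolding dim_span_pieces_Collect .
qed

context polarized_mhs
begin

lemma dim_F_step:
  assumes "finite T" "\<And>a b. (a, b) \<in> T \<Longrightarrow> a = p" "\<And>b. I p b \<noteq> {0} \<Longrightarrow> (p, b) \<in> T"
  shows "vec.dim (F p) = vec.dim (F (p + 1)) + (\<Sum>(a, b)\<in>T. vec.dim (I a b))"
proof -
  have F_eq: "F m = vec.span (\<Union>{I a b |a b. m \<le> a})" for m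
    using is_deligne_deligne unfolding is_deligne_def cspan_eq_span by blast
  show ?thesis
    unfolding F_eq[of p] F_eq[of "p + 1"]
  proof (rule dim_span_pieces_step[of T "\<lambda>a b. p \<le> a" "\<lambda>a b. p + 1 \<le> a"])
    fix a b assume "I a b \<noteq> {0}" "p \<le> a" "\<not> p + 1 \<le> a"
    moreover from this have "a = p"
      by simp
    ultimately show "(a, b) \<in> T"
      using assms(3) by blast
  qed (use assms(1,2) in auto)
qed

lemma dim_W_step:
  assumes "finite T" "\<And>a b. (a, b) \<in> T \<Longrightarrow> a + b = k" "\<And>a b. I a b \<noteq> {0} \<Longrightarrow> a + b = k \<Longrightarrow> (a, b) \<in> T"
  shows "vec.dim (W k) = vec.dim (W (k - 1)) + (\<Sum>(a, b)\<in>T. vec.dim (I a b))"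
proof -
  have W_eq: "W m = vec.span (\<Union>{I a b |a b. a + b \<le> m})" for m
    using is_deligne_deligne unfolding is_deligne_def cspan_eq_span by blast
  show ?thesis
    unfolding W_eq[of k] W_eq[of "k - 1"]
  proof (rule dim_span_pieces_step[of T "\<lambda>a b. a + b \<le> k" "\<lambda>a b. a + b \<le> k - 1"])
    fix a b assume "I a b \<noteq> {0}" "a + b \<le> k" "\<not> a + b \<le> k - 1"
    then show "(a, b) \<in> T"
      using assms(3)[of a b] by simp
  qed (use assms(1,2) in auto)
qed

end

lemma int_fun_shift_const:
  fixes d :: "int \<Rightarrow> 'a"
  assumes "\<And>p. d (p + 1) = d p"
  shows "d p = d q"
proof -
  have "d p = d 0" for p
  proof (induction p rule: int_induct[of _ 0])
    case (step2 i)
    then show ?case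
      using assms[of "i - 1"] by simp
  qed (use assms in auto)
  then show ?thesis
    by metis
qed

lemma hodge_numbers_typeI:
  assumes P: "polarized_mhs W F Q" and P': "polarized_mhs W F' Q"
    and F: "\<And>p. vec.dim (F p) = vec.dim (F' p)"
    and z: "\<And>p q. p + q \<notin> {k, k - 1} \<Longrightarrow> deligne W F p q = {0}"
    and z': "\<And>p q. p + q \<notin> {k, k - 1} \<Longrightarrow> deligne W F' p q = {0}"
  shows "vec.dim (deligne W F p q) = vec.dim (deligne W F' p q)"
proof -
  interpret P: polarized_mhs W F Q
    by (rule P)
  interpret P': polarized_mhs W F' Q
    by (rule P')
  let ?A = "\<lambda>p. vec.dim (P.I p (k - p))" and ?B = "\<lambda>p. vec.dim (P.I p (k - 1 - p))"
  let ?A' = "\<lambda>p. vec.dim (P'.I p (k - p))" and ?B' = "\<lambda>p. vec.dim (P'.I p (k - 1 - p))"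
  have b: "b = k - p \<or> b = k - 1 - p" if "P.I p b \<noteq> {0} \<or> P'.I p b \<noteq> {0}" for p b
  proof -
    have "p + b \<in> {k, k - 1}"
      using that z[of p b] z'[of p b] by blast
    then show ?thesis
      by auto
  qed
  have sum: "?A p + ?B p = ?A' p + ?B' p" for p
  proof -
    let ?T = "{(p, k - p), (p, k - 1 - p)}"
    have "vec.dim (F p) = vec.dim (F (p + 1)) + (\<Sum>(a, b)\<in>?T. vec.dim (P.I a b))"
      using b by (intro P.dim_F_step) auto
    moreover have "vec.dim (F' p) = vec.dim (F' (p + 1)) + (\<Sum>(a, b)\<in>?T. vec.dim (P'.I a b))"
      using b by (intro P'.dim_F_step) auto
    ultimately show ?thesis
      using F by simp
  qed
  \<comment> \<open>The excess in weight k. The step from F^{p+1} to F^p fixes only the total over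
    weights k and k - 1, so the excess in weight k - 1 is - d p; each weight contributes its own
    reflection symmetry.\<close>
  define d where "d p = int (?A p) - int (?A' p)" for p
  have d_B: "d p = int (?B' p) - int (?B p)" for p
    using sum[of p] by (simp add: d_def)
  have dA: "d (k - p) = d p" for p
    using P.dim_I_swap[of p "k - p"] P'.dim_I_swap[of p "k - p"] by (simp add: d_def)
  have dB: "d (k - 1 - p) = d p" for p
    using P.dim_I_swap[of p "k - 1 - p"] P'.dim_I_swap[of p "k - 1 - p"] by (simp add: d_B)
  \<comment> \<open>Reflection in weight k - 1 followed by reflection in weight k is the shift by
    one.\<close>
  have "d (p + 1) = d p" for p
    using dA[of "k - 1 - p"] dB[of p] by (simp add: algebra_simps)
  then have const: "d p = d q" for p q
    by (rule int_fun_shift_const)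
  have "finite (fst ` (bsupp P.I \<union> bsupp P'.I))"
    using P.finite_bsupp P'.finite_bsupp by simp
  then obtain m where "m \<notin> fst ` (bsupp P.I \<union> bsupp P'.I)"
    using ex_new_if_finite infinite_UNIV_int by blast
  then have "P.I m (k - m) = {0}" "P'.I m (k - m) = {0}"
    by (force simp: bsupp_def)+
  then have "d m = 0"
    by (simp add: d_def)
  then have d0: "d p = 0" for p
    using const by metis
  show ?thesis
  proof (cases "p + q \<in> {k, k - 1}")
    case True
    then have "q = k - p \<or> q = k - 1 - p"
      by auto
    then show ?thesis
      using d0[of p] d_B[of p] d_def[of p] by auto
  next
    case False
    then show ?thesis
      using z z' by simp
  qed
qed

text \<open>Parity separates the unknowns. In an even weight 2p only (p, p) can occur, so the
  dimensions of W give the diagonal; besides (p, p), only one piece with first index p can occur, of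
  odd weight 2k - 1, and the dimensions of F give it.\<close>

lemma hodge_numbers_typeII:
  assumes P: "polarized_mhs W F Q" and P': "polarized_mhs W F' Q"
    and F: "\<And>p. vec.dim (F p) = vec.dim (F' p)"
    and z: "\<And>p q. p + q \<noteq> 2 * k - 1 \<Longrightarrow> (p, q) \<notin> {(k, k), (k - 1, k - 1)} \<Longrightarrow> deligne W F p q = {0}"
    and z': "\<And>p q. p + q \<noteq> 2 * k - 1 \<Longrightarrow> (p, q) \<notin> {(k, k), (k - 1, k - 1)} \<Longrightarrow> deligne W F' p q = {0}"
  shows "vec.dim (deligne W F p q) = vec.dim (deligne W F' p q)"
proof -
  interpret P: polarized_mhs W F Q
    by (rule P)
  interpret P': polarized_mhs W F' Q
    by (rule P')
  have nz: "a + b = 2 * k - 1 \<or> a = b" if "P.I a b \<noteq> {0} \<or> P'.I a b \<noteq> {0}" for a b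
    using that z[of a b] z'[of a b] by blast
  have diag: "vec.dim (P.I p p) = vec.dim (P'.I p p)" for p
  proof -
    have c: "(a, b) \<in> {(p, p)}" if "P.I a b \<noteq> {0} \<or> P'.I a b \<noteq> {0}" "a + b = 2 * p" for a b
    proof -
      have "a + b \<noteq> 2 * k - 1"
        using that(2) by presburger
      then show ?thesis
        using nz[OF that(1)] that(2) by auto
    qed
    have "vec.dim (W (2 * p)) = vec.dim (W (2 * p - 1)) + (\<Sum>(a, b)\<in>{(p, p)}. vec.dim (P.I a b))"
      using c by (intro P.dim_W_step) auto
    moreover have "vec.dim (W (2 * p)) = vec.dim (W (2 * p - 1)) + (\<Sum>(a, b)\<in>{(p, p)}. vec.dim (P'.I a b))"
      using c by (intro P'.dim_W_step) auto
    ultimately show ?thesis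
      by simp
  qed
  have off: "vec.dim (P.I p (2 * k - 1 - p)) = vec.dim (P'.I p (2 * k - 1 - p))" for p
  proof -
    let ?T = "{(p, 2 * k - 1 - p), (p, p)}"
    have ne: "2 * k - 1 - p \<noteq> p"
      by presburger
    have c: "(p, b) \<in> ?T" if "P.I p b \<noteq> {0} \<or> P'.I p b \<noteq> {0}" for b
      using nz[OF that] by auto
    have "vec.dim (F p) = vec.dim (F (p + 1)) + (\<Sum>(a, b)\<in>?T. vec.dim (P.I a b))"
      using c by (intro P.dim_F_step) auto
    moreover have "vec.dim (F' p) = vec.dim (F' (p + 1)) + (\<Sum>(a, b)\<in>?T. vec.dim (P'.I a b))"
      using c by (intro P'.dim_F_step) auto
    ultimately show ?thesis
      using F diag[of p] ne by simp
  qed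
  show ?thesis
  proof (cases "P.I p q \<noteq> {0} \<or> P'.I p q \<noteq> {0}")
    case True
    have "q = 2 * k - 1 - p \<or> q = p"
      using nz[OF True] by auto
    then show ?thesis
      using off diag by auto
  qed simp
qed

section \<open>Isometries\<close>

lemma polarized_mhsI:
  assumes "weight_filtration W" "graded_forms W Q" "F \<in> classifying_space W Q hdim"
  shows "polarized_mhs W F Q"
  using assms unfolding classifying_space_def by unfold_locales auto

section \<open>The action of G on the classifying space\<close>

locale group_action = polarized_mhs W F Q
  for W F :: "int \<Rightarrow> (complex^('n::finite)) set" and Q :: "int \<Rightarrow> complex^'n \<Rightarrow> complex^'n \<Rightarrow> complex" +
  fixes g :: "complex^'n^'n"
  assumes g: "g \<in> Ggrp W Q"
begin

abbreviation gi :: "complex^'n^'n" where "gi \<equiv> matrix_inv g"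

lemma gi: "g ** gi = mat 1" "gi ** g = mat 1"
proof -
  have "invertible g"
    using g by (simp add: Ggrp_def)
  then have "\<exists>A'. g ** A' = mat 1 \<and> A' ** g = mat 1"
    by (simp add: invertible_def)
  then have "g ** gi = mat 1 \<and> gi ** g = mat 1"
    unfolding matrix_inv_def by (rule someI_ex)
  then show "g ** gi = mat 1" "gi ** g = mat 1"
    by auto
qed

lemma gi_simps [simp]: "g *v (gi *v v) = v" "gi *v (g *v v) = v"
  using gi by (simp_all add: matrix_vector_mul_assoc)

lemma inj_g: "inj ((*v) g)"
  by (rule inj_on_inverseI[of _ "(*v) gi"]) simp

lemma image_g_iff: "g *v v \<in> (*v) g ` A \<longleftrightarrow> v \<in> A"
  using inj_g by (simp add: inj_image_mem_iff)

lemma eq_image_g: "(\<And>v. g *v v \<in> A' \<longleftrightarrow> v \<in> A) \<Longrightarrow> A' = (*v) g ` A"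
  by (metis (no_types, lifting) gi_simps(1) image_g_iff set_eqI)

lemma g_W: "g *v v \<in> W k \<longleftrightarrow> v \<in> W k"
  using g image_g_iff[of v "W k"] by (simp add: Ggrp_def)

lemma gi_W: "gi *v v \<in> W k \<longleftrightarrow> v \<in> W k"
  using g_W[of "gi *v v" k] by simp

lemma g_Q: "u \<in> W k \<Longrightarrow> v \<in> W k \<Longrightarrow> Q k (g *v u) (g *v v) = Q k u v"
  using g by (simp add: Ggrp_def)

lemma g_real: "v \<in> W k \<Longrightarrow> vcnj (g *v v) - g *v vcnj v \<in> W (k - 1)"
  using g by (simp add: Ggrp_def gr_real_def)

text \<open>Gr(g) is real, so conjugating before or after g makes a difference in W_{k-1}, which
  \<open>Q k\<close> ignores.\<close>

lemma g_Q_vcnj: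
  assumes "u \<in> W k" "v \<in> W k"
  shows "Q k (g *v u) (vcnj (g *v v)) = Q k u (vcnj v)"
proof -
  have "Q k (g *v u) (vcnj (g *v v)) = Q k (g *v u) (g *v vcnj v)"
    by (rule Q_cong) (use assms g_W vcnj_W g_real W_closed in auto)
  then show ?thesis
    using g_Q assms vcnj_W by simp
qed

lemma g_act: "g *v v \<in> act g F p \<longleftrightarrow> v \<in> F p"
  unfolding act_def by (rule image_g_iff)

lemma g_Fgr: "g *v v \<in> Fgr W (act g F) k p \<longleftrightarrow> v \<in> Fgr W F k p"
proof
  assume "g *v v \<in> Fgr W (act g F) k p"
  then obtain a b where ab: "g *v v = a + b" "a \<in> act g F p" "a \<in> W k" "b \<in> W (k - 1)"
    unfolding Fgr_def sumsp_def by blast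
  have "v = gi *v a + gi *v b"
    using arg_cong[OF ab(1), of "(*v) gi"] by (simp add: matrix_vector_right_distrib)
  moreover have "gi *v a \<in> F p"
    using ab(2) g_act[of "gi *v a" p] by simp
  ultimately show "v \<in> Fgr W F k p"
    unfolding Fgr_def sumsp_def using ab gi_W by blast
next
  assume "v \<in> Fgr W F k p"
  then obtain a b where "v = a + b" "a \<in> F p" "a \<in> W k" "b \<in> W (k - 1)"
    unfolding Fgr_def sumsp_def by blast
  then show "g *v v \<in> Fgr W (act g F) k p"
    unfolding Fgr_def sumsp_def using g_act g_W matrix_vector_right_distrib[of g a b] by blast
qed

text \<open>The failure of g to commute with conjugation on W_k lies in W_{k-1}, and
  \<open>Fgr\<close> absorbs it. A vector outside W_k satisfies neither side.\<close>

lemma g_cnjset_Fgr: "g *v v \<in> cnjset (Fgr W (act g F) k p) \<longleftrightarrow> v \<in> cnjset (Fgr W F k p)"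
proof (cases "v \<in> W k")
  case True
  let ?w = "vcnj (g *v v) - g *v vcnj v"
  have w: "?w \<in> W (k - 1)" "- ?w \<in> W (k - 1)"
    using g_real[OF True] W_closed(4) by blast+
  have "vcnj (g *v v) \<in> Fgr W (act g F) k p \<longleftrightarrow> g *v vcnj v \<in> Fgr W (act g F) k p"
    using Fgr_add_low[OF _ w(1), of "g *v vcnj v"] Fgr_add_low[OF _ w(2), of "vcnj (g *v v)"] by auto
  then show ?thesis
    by (simp add: mem_cnjset g_Fgr)
next
  case False
  then have "vcnj v \<notin> W k" "vcnj (g *v v) \<notin> W k"
    using vcnj_W[of "vcnj v"] vcnj_W[of "vcnj (g *v v)"] g_W by auto
  then show ?thesis
    using Fgr_W by (auto simp: mem_cnjset)
qed

lemma linear_g: "Vector_Spaces.linear (*s) (*s) ((*v) g)"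
  by (rule matrix_vector_mul_linear_gen)

lemma act_MHS: "is_MHS W (act g F)"
  unfolding is_MHS_def
proof (intro allI conjI)
  fix k p
  let ?A = "Fgr W F k p" and ?B = "cnjset (Fgr W F k (k - p + 1))"
  have A: "Fgr W (act g F) k p = (*v) g ` ?A"
    by (rule eq_image_g) (rule g_Fgr)
  have B: "cnjset (Fgr W (act g F) k (k - p + 1)) = (*v) g ` ?B"
    by (rule eq_image_g) (rule g_cnjset_Fgr)
  have W: "W l = (*v) g ` W l" for l
    by (rule eq_image_g) (rule g_W)
  have s: "sumsp ((*v) g ` ?A) ((*v) g ` ?B) = (*v) g ` sumsp ?A ?B"
    unfolding sumsp_def by (force simp: matrix_vector_right_distrib)
  have AB: "sumsp ?A ?B = W k" "?A \<inter> ?B = W (k - 1)"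
    using mhs by (simp_all add: is_MHS_def)
  show "sumsp (Fgr W (act g F) k p) (cnjset (Fgr W (act g F) k (k - p + 1))) = W k"
    unfolding A B s AB by (rule W[symmetric])
  show "Fgr W (act g F) k p \<inter> cnjset (Fgr W (act g F) k (k - p + 1)) = W (k - 1)"
    unfolding A B image_Int[OF inj_g, symmetric] AB by (rule W[symmetric])
qed

lemma act_polarized: "graded_polarized W Q (act g F)"
  unfolding graded_polarized_def
proof (intro allI conjI ballI impI)
  fix k p u v assume "u \<in> act g F p \<inter> W k" "v \<in> act g F (k - p + 1) \<inter> W k"
  then have "gi *v u \<in> F p \<inter> W k" "gi *v v \<in> F (k - p + 1) \<inter> W k"
    using g_act[of "gi *v u" p] g_act[of "gi *v v" "k - p + 1"] gi_W by auto
  moreover from this have "Q k (gi *v u) (gi *v v) = 0"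
    using pol unfolding graded_polarized_def by blast
  ultimately show "Q k u v = 0"
    using g_Q[of "gi *v u" k "gi *v v"] by simp
next
  fix k p v assume v: "v \<in> hodge_lift W (act g F) k p" "v \<notin> W (k - 1)"
  have "gi *v v \<in> hodge_lift W F k p"
    using v(1) g_Fgr[of "gi *v v" k p] g_cnjset_Fgr[of "gi *v v" k "k - p"] by (simp add: hodge_lift_def)
  moreover have "gi *v v \<in> W k"
    using calculation Fgr_W unfolding hodge_lift_def by blast
  moreover have "Q k v (vcnj v) = Q k (gi *v v) (vcnj (gi *v v))"
    using g_Q_vcnj[of "gi *v v" k "gi *v v"] calculation(2) by simp
  moreover have "gi *v v \<notin> W (k - 1)"
    using v(2) gi_W by simp
  ultimately show "Im (\<i> powi (p - (k - p)) * Q k v (vcnj v)) = 0" "Re (\<i> powi (p - (k - p)) * Q k v (vcnj v)) > 0"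
    using pol unfolding graded_polarized_def by metis+
qed

lemma subspace_act: "vec.subspace (act g F p)"
  unfolding act_def by (rule vec.linear_subspace_image[OF linear_g subspace_F])

lemma act_hodge_filtration: "hodge_filtration (act g F)"
proof -
  have "surj ((*v) g)"
    by (rule surjI[of _ "(*v) gi"]) simp
  moreover obtain a b where "\<And>p. p \<le> a \<Longrightarrow> F p = UNIV" "\<And>p. b \<le> p \<Longrightarrow> F p = {0}"
    using F_bounds by metis
  ultimately have "\<forall>p. (p \<le> a \<longrightarrow> act g F p = UNIV) \<and> (b \<le> p \<longrightarrow> act g F p = {0})"
    by (simp add: act_def)
  moreover have "act g F (p + 1) \<subseteq> act g F p" for p
    unfolding act_def using F_Suc by (rule image_mono)
  ultimately show ?thesis
    using subspace_act unfolding hodge_filtration_def csubspace_eq_subspace by blast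
qed

lemma dim_act: "vec.dim (act g F p) = vec.dim (F p)"
  unfolding act_def by (rule vec.dim_image_eq[OF linear_g]) (rule inj_on_subset[OF inj_g subset_UNIV])

lemma polarized_act: "polarized_mhs W (act g F) Q"
  by unfold_locales (fact act_hodge_filtration act_MHS act_polarized gf)+

lemma act_classifying_space:
  assumes "F \<in> classifying_space W Q hdim"
  shows "act g F \<in> classifying_space W Q hdim"
  using assms act_hodge_filtration act_MHS act_polarized dim_act
  by (simp add: classifying_space_def cdim_eq_dim subspace_act subspace_F)

end

lemma conjugate_sum:
  fixes g g' :: "complex^('n::finite)^'n"
  shows "g ** sum Y S ** g' = (\<Sum>x\<in>S. g ** Y x ** g')"
proof (induction S rule: infinite_finite_induct)
  case (insert x S)
  then show ?case
    by (simp add: matrix_eq matrix_vector_mul_assoc[symmetric] matrix_vector_mult_add_rdistrib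
        matrix_vector_right_distrib)
qed (auto simp: matrix_eq matrix_vector_mul_assoc[symmetric])

section \<open>Tangent representatives and adjoints\<close>

context polarized_mhs
begin

text \<open>Every summand of an element of t_F has r < 0, so it strictly lowers the first index on
  each piece.\<close>

lemma tangent_lowers:
  assumes X: "X \<in> tangent W Q F" and v: "v \<in> I p q" and a: "p \<le> a"
  shows "cmp a b (X *v v) = 0"
proof -
  obtain S Y where SY: "X = sum Y S" "\<And>rs. rs \<in> S \<Longrightarrow> fst rs < 0 \<and> Y rs \<in> gC_rs W Q F (fst rs) (snd rs)"
    using X unfolding tangent_def by blast
  have sum: "sum Y S *v v = (\<Sum>rs\<in>S. Y rs *v v)"
    by (induction S rule: infinite_finite_induct) (auto simp: matrix_vector_mult_add_rdistrib)
  have "cmp a b (Y rs *v v) = 0" if "rs \<in> S" for rs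
  proof -
    have "Y rs *v v \<in> I (p + fst rs) (q + snd rs)"
      using SY(2)[OF that] v by (auto simp: gC_rs_def)
    then show ?thesis
      using SY(2)[OF that] a by (auto simp: bcomp_piece)
  qed
  then show ?thesis
    unfolding SY(1) sum bcomp_simps by simp
qed

lemma eq_zero_if_pieces:
  fixes D :: "complex^'n^'n"
  assumes "\<And>p q v. v \<in> I p q \<Longrightarrow> D *v v = 0"
  shows "D = 0"
proof -
  have "D *v v = 0" for v
  proof -
    have "D *v v = D *v (\<Sum>(p, q)\<in>bsupp I. cmp p q v)"
      by (simp only: bcomp_sum)
    also have "\<dots> = (\<Sum>(p, q)\<in>bsupp I. D *v cmp p q v)"
      by (simp add: vec.linear_sum[OF matrix_vector_mul_linear_gen] case_prod_unfold)
    also have "\<dots> = 0"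
      by (simp add: assms[OF bcomp_in])
    finally show ?thesis .
  qed
  then show ?thesis
    by (simp add: matrix_eq)
qed

text \<open>X - X' preserves F but strictly lowers the first index on each I^{p,q}, hence vanishes:
  t_F meets the stabilizer of F trivially. This makes the definite description in
  \<open>Lstar\<close> unambiguous.\<close>

lemma tangent_representative_unique:
  assumes X: "X \<in> tangent W Q F" "X' \<in> tangent W Q F" and "preserves (Y - X) F" "preserves (Y - X') F"
  shows "X = X'"
proof -
  have "X - X' = 0"
  proof (rule eq_zero_if_pieces, rule eq_zero_if_bcomp)
    fix p q v a b assume v: "v \<in> I p q"
    show "cmp a b ((X - X') *v v) = 0"
    proof (cases "p \<le> a")
      case True
      then show ?thesis
        using tangent_lowers[OF X(1) v True, of b] tangent_lowers[OF X(2) v True, of b]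
        by (simp add: matrix_vector_mult_diff_rdistrib bcomp_simps)
    next
      case False
      have "(Y - X') *v v - (Y - X) *v v \<in> F p"
        using assms(3,4) I_F[OF v] F_closed(2) unfolding preserves_def by blast
      then show ?thesis
        using False by (simp add: F_iff matrix_vector_mult_diff_rdistrib)
    qed
  qed
  then show ?thesis
    by simp
qed

lemma mh_adjoint: "hform (A *v u) v = hform u (mh_adjoint W Q F A *v v)"
  and mh_adjoint_unique: "(\<And>u v. hform (A *v u) v = hform u (B *v v)) \<Longrightarrow> mh_adjoint W Q F A = B"
proof -
  note ex1 = adjoint_unique_exists[OF inner_form_hform, of A]
  have def: "mh_adjoint W Q F A = (THE B. \<forall>u v. hform (A *v u) v = hform u (B *v v))"
    by (simp add: mh_adjoint_def mh_metric_eq)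
  show "hform (A *v u) v = hform u (mh_adjoint W Q F A *v v)"
    using theI'[OF ex1] unfolding def by blast
  show "mh_adjoint W Q F A = B" if "\<And>u v. hform (A *v u) v = hform u (B *v v)"
    unfolding def using that by (intro the1_equality[OF ex1]) blast
qed

end

text \<open>The second assumption is what types (I) and (II) have in common: every nonzero piece at least two weights
  below \<open>I\<^sup>p\<^sup>,\<^sup>q\<close> lies in the error term of the conjugation condition for \<open>I\<^sup>p\<^sup>,\<^sup>q\<close>.\<close>

locale isometric_action = group_action W F Q g
  for W F :: "int \<Rightarrow> (complex^('n::finite)) set" and Q :: "int \<Rightarrow> complex^'n \<Rightarrow> complex^'n \<Rightarrow> complex"
    and g :: "complex^'n^'n" +
  assumes gH: "g \<in> Hgrp W Q"
    and short: "\<And>p q a b. deligne W F p q \<noteq> {0} \<Longrightarrow> deligne W F a b \<noteq> {0} \<Longrightarrow> a + b \<le> p + q - 2 \<Longrightarrow> a < q \<and> b < p"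
begin

lemma W_short:
  assumes "I p q \<noteq> {0}"
  shows "W (p + q - 2) \<subseteq> vec.span (\<Union>{I r s |r s. r < q \<and> s < p})"
proof
  fix v assume v: "v \<in> W (p + q - 2)"
  have "cmp a b v = 0" if "\<not> (a < q \<and> b < p)" for a b
  proof (cases "a + b \<le> p + q - 2")
    case True
    then have "I a b = {0}"
      using short[OF assms] that by blast
    then show ?thesis
      using bcomp_in[of a b v] by blast
  next
    case False
    then show ?thesis
      using v by (simp add: W_iff)
  qed
  then show "v \<in> vec.span (\<Union>{I r s |r s. r < q \<and> s < p})"
    unfolding span_pieces_iff by blast
qed

lemma span_g_image:
  "vec.span (\<Union>{(*v) g ` I a b |a b. P a b}) = (*v) g ` vec.span (\<Union>{I a b |a b. P a b})"
proof -
  have "\<Union>{(*v) g ` I a b |a b. P a b} = (*v) g ` \<Union>{I a b |a b. P a b}"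
    by blast
  then show ?thesis
    using vec.linear_span_image[OF linear_g] by simp
qed

lemma is_bigrading_act: "is_bigrading (\<lambda>p q. (*v) g ` I p q)"
  unfolding is_bigrading_def csubspace_eq_subspace cspan_eq_span
proof (intro conjI allI impI)
  show "vec.subspace ((*v) g ` I p q)" for p q
    by (rule vec.linear_subspace_image[OF linear_g subspace_piece])
  have "(*v) g ` I p q = {0} \<longleftrightarrow> I p q = {0}" for p q
    using inj_image_eq_iff[OF inj_g, of "I p q" "{0}"] by simp
  then show "finite {(p, q). (*v) g ` I p q \<noteq> {0}}"
    using finite_bsupp by (simp add: bsupp_def)
  have "surj ((*v) g)"
    by (rule surjI[of _ "(*v) gi"]) simp
  moreover have "(\<Union>p q. (*v) g ` I p q) = (*v) g ` (\<Union>p q. I p q)"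
    by blast
  ultimately show "vec.span (\<Union>p q. (*v) g ` I p q) = UNIV"
    using vec.linear_span_image[OF linear_g, of "\<Union>p q. I p q"] span_pieces by simp
next
  fix S and f :: "int \<times> int \<Rightarrow> complex^'n"
  assume S: "finite S" and f: "\<forall>(p, q)\<in>S. f (p, q) \<in> (*v) g ` I p q" and "sum f S = 0"
  have "f (p, q) = 0" if pq: "(p, q) \<in> S" for p q
  proof -
    have "(\<Sum>(a, b)\<in>S. gi *v f (a, b)) = gi *v sum f S"
      by (simp add: vec.linear_sum[OF matrix_vector_mul_linear_gen] case_prod_unfold)
    then have "(\<Sum>(a, b)\<in>S. gi *v f (a, b)) = 0"
      using \<open>sum f S = 0\<close> by simp
    moreover have "gi *v f (a, b) \<in> I a b" if "(a, b) \<in> S" for a b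
      using f that image_g_iff[of "gi *v f (a, b)" "I a b"] by auto
    ultimately have "gi *v f (p, q) = 0"
      using pieces_independent[OF S, of "\<lambda>a b. gi *v f (a, b)"] pq by blast
    then have "g *v (gi *v f (p, q)) = 0"
      by (simp only: matrix_vector_mult_0_right)
    then show ?thesis
      by simp
  qed
  then show "\<forall>x\<in>S. f x = 0"
    by auto
qed

lemma is_deligne_act: "is_deligne W (act g F) (\<lambda>p q. (*v) g ` I p q)"
  unfolding is_deligne_def cspan_eq_span
proof (intro conjI allI ballI)
  have F_eq: "F p = vec.span (\<Union>{I a b |a b. p \<le> a})" for p
    using is_deligne_deligne unfolding is_deligne_def cspan_eq_span by blast
  have W_eq: "W k = vec.span (\<Union>{I a b |a b. a + b \<le> k})" for k
    using is_deligne_deligne unfolding is_deligne_def cspan_eq_span by blast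
  show "is_bigrading (\<lambda>p q. (*v) g ` I p q)"
    by (rule is_bigrading_act)
  show "act g F p = vec.span (\<Union>{(*v) g ` I a b |a b. p \<le> a})" for p
    unfolding span_g_image act_def by (rule arg_cong[OF F_eq])
  have "(*v) g ` W k = W k" for k
    using g by (simp add: Ggrp_def)
  then show "W k = vec.span (\<Union>{(*v) g ` I a b |a b. a + b \<le> k})" for k
    unfolding span_g_image using W_eq[of k] by metis
next
  fix p q v assume "v \<in> (*v) g ` I p q"
  then obtain x where x: "v = g *v x" "x \<in> I p q"
    by blast
  let ?L = "vec.span (\<Union>{I r s |r s. r < q \<and> s < p})"
  show "vcnj v \<in> sumsp ((*v) g ` I q p) (vec.span (\<Union>{(*v) g ` I r s |r s. r < q \<and> s < p}))"
  \<comment> \<open>The inclusion of W_{p+q-2} in the error term is available for nonzero pieces, so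
    x = 0 is treated apart.\<close>
  proof (cases "x = 0")
    case True
    then have "vcnj v = g *v 0 + g *v 0"
      using x by simp
    then show ?thesis
      unfolding span_g_image sumsp_def using zero_piece vec.span_zero by blast
  next
    case False
    then have nz: "I p q \<noteq> {0}"
      using x by blast
    obtain a e where a: "vcnj x = a + e" "a \<in> I q p" "e \<in> ?L"
      using is_deligne_deligne x unfolding is_deligne_def cspan_eq_span sumsp_def by blast
    \<comment> \<open>The failure of g to commute with conjugation at x, pulled back by g; it is
      added to the error term e of x.\<close>
    let ?w = "gi *v (vcnj v - g *v vcnj x)"
    have "vcnj v - g *v vcnj x \<in> W (p + q - 2)"
      using gH I_W[OF x(2)] x(1) by (simp add: Hgrp_def gr_real_def)
    then have "?w \<in> ?L"
      using W_short[OF nz] gi_W by blast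
    then have "e + ?w \<in> ?L"
      using a(3) vec.span_add by blast
    moreover have "vcnj v = g *v a + g *v (e + ?w)"
      by (simp add: matrix_vector_right_distrib a(1))
    ultimately show ?thesis
      unfolding span_g_image sumsp_def using a(2) by blast
  qed
qed

sublocale act: polarized_mhs W "act g F" Q
  by (rule polarized_act)

lemma deligne_act: "deligne W (act g F) p q = (*v) g ` I p q"
  using act.deligne_eq[OF is_deligne_act] by metis

text \<open>The pull-back of the metric of g.F has the properties that determine the metric of F: g
  maps pieces to pieces, and on a piece \<open>g_Q_vcnj\<close> gives the equality.\<close>

lemma hform_act: "act.hform (g *v u) (g *v v) = hform u v"
proof -
  have "(\<lambda>u v. act.hform (g *v u) (g *v v)) = hform"
  proof (rule hform_unique)
    show "sesquilinear (\<lambda>u v. act.hform (g *v u) (g *v v))"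
      using act.sesquilinear_hform vec.linear_scale[OF linear_g]
      unfolding sesquilinear_def by (simp add: matrix_vector_right_distrib)
  next
    fix p q p' q' u v assume "(p, q) \<noteq> (p', q')" "u \<in> I p q" "v \<in> I p' q'"
    then show "act.hform (g *v u) (g *v v) = 0"
      by (intro act.hform_orthogonal[of _ p q _ p' q']) (auto simp: deligne_act)
  next
    fix p q u v assume uv: "u \<in> I p q" "v \<in> I p q"
    then have "act.hform (g *v u) (g *v v) = \<i> powi (p - q) * Q (p + q) (g *v u) (vcnj (g *v v))"
      by (intro act.hform_piece) (auto simp: deligne_act)
    then show "act.hform (g *v u) (g *v v) = \<i> powi (p - q) * Q (p + q) u (vcnj v)"
      using g_Q_vcnj[OF I_W I_W] uv by simp
  qed
  then show ?thesis
    by metis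
qed

lemma conj_mult: "(g ** A ** gi) *v v = g *v (A *v (gi *v v))"
  by (simp add: matrix_vector_mul_assoc matrix_mul_assoc)

lemma gC_rs_conj:
  assumes X: "X \<in> gC_rs W Q F r s"
  shows "g ** X ** gi \<in> gC_rs W Q (act g F) r s"
proof -
  have XW: "X *v v \<in> W k" if "v \<in> W k" for v k
    using X that by (auto simp: gC_rs_def lie_gC_def)
  have XQ: "Q k (X *v u) v + Q k u (X *v v) = 0" if "u \<in> W k" "v \<in> W k" for u v k
    using X that by (auto simp: gC_rs_def lie_gC_def)
  have "Q k (g *v (X *v (gi *v u))) v + Q k u (g *v (X *v (gi *v v))) = 0" if uv: "u \<in> W k" "v \<in> W k" for u v k
  proof -
    have "gi *v u \<in> W k" "gi *v v \<in> W k"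
      using uv gi_W by auto
    then show ?thesis
      using g_Q[of "X *v (gi *v u)" k "gi *v v"] g_Q[of "gi *v u" k "X *v (gi *v v)"] XW XQ by simp
  qed
  moreover have "g *v (X *v (gi *v v)) \<in> (*v) g ` I (p + r) (q + s)" if "v \<in> (*v) g ` I p q" for v p q
    using X that by (auto simp: gC_rs_def)
  moreover have "g *v (X *v (gi *v v)) \<in> W k" if "v \<in> W k" for v k
    using XW[of "gi *v v" k] that by (simp only: gi_W g_W)
  ultimately show ?thesis
    unfolding gC_rs_def lie_gC_def mem_Collect_eq deligne_act conj_mult
    by (intro conjI allI ballI)
qed

lemma tangent_conj:
  assumes "X \<in> tangent W Q F"
  shows "g ** X ** gi \<in> tangent W Q (act g F)"
proof -
  obtain S Y where SY: "X = sum Y S" "finite S" "\<forall>rs\<in>S. fst rs < 0 \<and> Y rs \<in> gC_rs W Q F (fst rs) (snd rs)"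
    using assms unfolding tangent_def by blast
  have "g ** X ** gi = (\<Sum>rs\<in>S. g ** Y rs ** gi)"
    unfolding SY(1) by (rule conjugate_sum)
  then show ?thesis
    unfolding tangent_def using SY gC_rs_conj by (simp, blast)
qed

text \<open>The conjugate of X already lies in t_{g.F}, so no correction by the stabilizer occurs
  and uniqueness of representatives applies.\<close>

lemma Lstar_eq:
  assumes X: "X \<in> tangent W Q F"
  shows "Lstar W Q g F X = g ** X ** gi"
proof -
  have "preserves (g ** X ** gi - g ** X ** gi) (act g F)"
    using act.F_closed(5) by (simp add: preserves_def)
  then show ?thesis
    unfolding Lstar_def
    using tangent_conj[OF X] act.tangent_representative_unique by (intro the_equality) blast+
qed

lemma mh_adjoint_conj: "mh_adjoint W Q (act g F) (g ** A ** gi) = g ** mh_adjoint W Q F A ** gi"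
proof (rule act.mh_adjoint_unique)
  fix u v
  have "act.hform ((g ** A ** gi) *v u) v = act.hform (g *v (A *v (gi *v u))) (g *v (gi *v v))"
    by (simp add: conj_mult)
  also have "\<dots> = hform (gi *v u) (mh_adjoint W Q F A *v (gi *v v))"
    by (simp only: hform_act mh_adjoint)
  also have "\<dots> = act.hform (g *v (gi *v u)) (g *v (mh_adjoint W Q F A *v (gi *v v)))"
    by (simp only: hform_act)
  finally show "act.hform ((g ** A ** gi) *v u) v = act.hform u ((g ** mh_adjoint W Q F A ** gi) *v v)"
    by (simp add: conj_mult)
qed

lemma tangent_metric_act:
  assumes "X \<in> tangent W Q F" "Y \<in> tangent W Q F"
  shows "tangent_metric W Q (act g F) (Lstar W Q g F X) (Lstar W Q g F Y) = tangent_metric W Q F X Y"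
proof -
  let ?B = "mh_adjoint W Q F Y"
  have "(g ** X ** gi) ** (g ** ?B ** gi) = g ** (X ** (gi ** g) ** (?B ** gi))"
    by (simp only: matrix_mul_assoc)
  then have "trace ((g ** X ** gi) ** (g ** ?B ** gi)) = trace (g ** (X ** (?B ** gi)))"
    by (simp only: gi matrix_mul_rid)
  also have "\<dots> = trace (X ** (?B ** gi) ** g)"
    by (rule trace_mul_sym)
  also have "X ** (?B ** gi) ** g = X ** (?B ** (gi ** g))"
    by (simp only: matrix_mul_assoc)
  finally have "trace ((g ** X ** gi) ** (g ** ?B ** gi)) = trace (X ** ?B)"
    by (simp only: gi matrix_mul_rid)
  then show ?thesis
    using assms by (simp add: tangent_metric_def Lstar_eq mh_adjoint_conj)
qed

end

theorem theorem2p19: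
  fixes W :: "int \<Rightarrow> (complex ^ ('n::finite)) set"
    and Q :: "int \<Rightarrow> complex ^ 'n \<Rightarrow> complex ^ 'n \<Rightarrow> complex"
    and hdim :: "int \<Rightarrow> nat"
  assumes "weight_filtration W"
    and "graded_forms W Q"
    and "typeI W Q hdim \<or> typeII W Q hdim"
  shows "(\<forall>g\<in>Hgrp W Q. \<forall>F\<in>classifying_space W Q hdim. act g F \<in> classifying_space W Q hdim)
       \<and> (\<forall>F\<in>classifying_space W Q hdim. \<forall>F'\<in>classifying_space W Q hdim. \<exists>g\<in>Hgrp W Q. act g F = F')
       \<and> (\<forall>g\<in>Hgrp W Q. \<forall>F\<in>classifying_space W Q hdim. \<forall>u\<in>tangent W Q F. \<forall>v\<in>tangent W Q F.
            tangent_metric W Q (act g F) (Lstar W Q g F u) (Lstar W Q g F v) = tangent_metric W Q F u v)"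
proof (intro conjI ballI)
  fix g F assume g: "g \<in> Hgrp W Q" and F: "F \<in> classifying_space W Q hdim"
  interpret group_action W F Q g
    using polarized_mhsI[OF assms(1,2) F] g
    by (simp add: group_action_def group_action_axioms_def Hgrp_def)
  show "act g F \<in> classifying_space W Q hdim"
    by (rule act_classifying_space[OF F])
next
  fix F F' assume F: "F \<in> classifying_space W Q hdim" "F' \<in> classifying_space W Q hdim"
  note P = polarized_mhsI[OF assms(1,2) F(1)] polarized_mhsI[OF assms(1,2) F(2)]
  interpret P: polarized_mhs W F Q
    by (rule P)
  interpret P': polarized_mhs W F' Q
    by (rule P)
  have dimF: "vec.dim (F p) = vec.dim (F' p)" for p
    using F cdim_eq_dim[OF P.subspace_F, of p] cdim_eq_dim[OF P'.subspace_F, of p]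
    by (simp add: classifying_space_def)
  have "vec.dim (deligne W F p q) = vec.dim (deligne W F' p q)" for p q
    using assms(3)
  proof
    assume "typeI W Q hdim"
    then obtain k where "\<forall>F\<in>classifying_space W Q hdim. \<forall>p q. p + q \<notin> {k, k - 1} \<longrightarrow> deligne W F p q = {0}"
      unfolding typeI_def by blast
    then show ?thesis
      using F by (intro hodge_numbers_typeI[OF P dimF, of k]) blast+
  next
    assume "typeII W Q hdim"
    then obtain k where "\<forall>F\<in>classifying_space W Q hdim. \<forall>p q.
        p + q \<noteq> 2 * k - 1 \<and> (p, q) \<notin> {(k, k), (k - 1, k - 1)} \<longrightarrow> deligne W F p q = {0}"
      unfolding typeII_def by blast
    then show ?thesis
      using F by (intro hodge_numbers_typeII[OF P dimF, of k]) blast+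
  qed
  then show "\<exists>g\<in>Hgrp W Q. act g F = F'"
    by (rule hodge_isometry_exists[OF P])
next
  fix g F u v assume g: "g \<in> Hgrp W Q" and F: "F \<in> classifying_space W Q hdim"
    and uv: "u \<in> tangent W Q F" "v \<in> tangent W Q F"
  \<comment> \<open>Type (I) has two adjacent weights, so no nonzero piece lies two weights below
    another; in type (II) the only such pair is (k - 1, k - 1) below (k, k).\<close>
  have short: "a < q \<and> b < p"
    if nz: "deligne W F p q \<noteq> {0}" "deligne W F a b \<noteq> {0}" and le: "a + b \<le> p + q - 2" for p q a b
    using assms(3)
  proof
    assume "typeI W Q hdim"
    then obtain k where "\<And>p q. deligne W F p q \<noteq> {0} \<Longrightarrow> p + q \<in> {k, k - 1}"
      using F unfolding typeI_def by blast
    from this[OF nz(1)] this[OF nz(2)] show ?thesis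
      using le by auto
  next
    assume "typeII W Q hdim"
    then obtain k where "\<And>p q. deligne W F p q \<noteq> {0} \<Longrightarrow> p + q = 2 * k - 1 \<or> (p, q) \<in> {(k, k), (k - 1, k - 1)}"
      using F unfolding typeII_def by blast
    from this[OF nz(1)] this[OF nz(2)] show ?thesis
      using le by auto
  qed
  interpret isometric_action W F Q g
  proof (intro isometric_action.intro group_action.intro group_action_axioms.intro isometric_action_axioms.intro)
    show "polarized_mhs W F Q"
      by (rule polarized_mhsI[OF assms(1,2) F])
    show "g \<in> Ggrp W Q" "g \<in> Hgrp W Q"
      using g by (auto simp: Hgrp_def)
  qed (use short in auto)
  show "tangent_metric W Q (act g F) (Lstar W Q g F u) (Lstar W Q g F v) = tangent_metric W Q F u v"
    by (rule tangent_metric_act[OF uv])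
qed

end
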